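(* Let $x_t, s_{0|t}\in\mathbb{R}^n$, $v_{0|t}\in\mathbb{R}^m$, and put $s_{1|t}=As_{0|t}+Bv_{0|t}$ and $x_{1|t}=(A+BK)x_t-BKs_{0|t}+Bv_{0|t}+w(x_t)$. For any $\tau\in\{1,\dots,n\}$ and $i\in\{1,2\}$, the distributionally robust CVaR constraint $$\sup_{\mathbb{Q}\in \mathcal{Q}_\tau(x_{1|t})}\mathbb{Q}\text{-CVaR}_{\varepsilon}\left\{(-1)^i\left(x_{1|t}^{(\tau)}-\tilde x_i^{(\tau)}\right)\right\}\le 0$$ is satisfied if and only if $$(-1)^i\left[s_{1|t}^{(\tau)}+\left((A+BK)(x_t-s_{0|t})\right)^{(\tau)}\right]\le(-1)^i\tilde x_i^{(\tau)}-\eta_{i,t}^{(\tau)},$$ where $\eta_{i,t}^{(\tau)}$ is the optimal value of the following second-order cone program in the real variables $\eta,\beta$ and $t_j,\omega_j,\Omega_j,\varphi_{1,j},\varphi_{2,j},\phi_{1,j},\phi_{2,j}$, $j=1,\dots,M_\tau$ (with $\mu_j=\mu_{\tau,j}(x_t)$, $\Sigma_j=\Sigma_{\tau,j}(x_t)$, $\gamma_j=\gamma_{\tau,t,j}$): $$\begin{aligned} \min\ &\eta\\ \text{s.t. }&\varepsilon\beta+\sum_{j=1}^{M_\tau}\gamma_j\left\{t_j+\mu_j\omega_j+(\Sigma_j+\mu_j^2)\Omega_j\right\}\le 0,\\ &\left\|\begin{pmatrix}\omega_j+\varphi_{1,j}-\varphi_{2,j}\\ \Omega_j-t_j+\tilde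 w_2^{(\tau)}\varphi_{1,j}-\tilde w_1^{(\tau)}\varphi_{2,j}\end{pmatrix}\right\|_2\le\Omega_j+t_j-\tilde w_2^{(\tau)}\varphi_{1,j}+\tilde w_1^{(\tau)}\varphi_{2,j},\\ &\left\|\begin{pmatrix}\omega_j-(-1)^i+\phi_{1,j}-\phi_{2,j}\\ \Omega_j-t_j-\beta-\eta+\tilde w_2^{(\tau)}\phi_{1,j}-\tilde w_1^{(\tau)}\phi_{2,j}\end{pmatrix}\right\|_2\le\Omega_j+t_j+\beta+\eta-\tilde w_2^{(\tau)}\phi_{1,j}+\tilde w_1^{(\tau)}\phi_{2,j},\\ &\Omega_j\ge0,\ \varphi_{1,j}\ge0,\ \varphi_{2,j}\ge0,\ \phi_{1,j}\ge0,\ \phi_{2,j}\ge0,\qquad\forall j\in\{1,\dots,M_\tau\}. \end{aligned}$$ Consequently, with $\eta_{i,t}=(\eta_{i,t}^{(1)},\dots,\eta_{i,t}^{(n)})^\top$, the $2n$ constraints (all $i\in\{1,2\}$, $\tau\in\{1,\dots,n\}$) hold simultaneously if and only if $$s_{1|t}+(A+BK)(x_t-s_{0|t})\in[\tilde x_1+\eta_{1,t},\ \tilde x_2-\eta_{2,t}].$$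
   Context: Superscript $(\tau)$ denotes the $\tau$-th component of a vector, and $[a,b]$ for vectors denotes the set of $x$ with $a\le x\le b$ componentwise. System: $x_{k+1}=Ax_k+Bu_k+w(x_k)$ with $A\in\mathbb{R}^{n\times n}$, $B\in\mathbb{R}^{n\times m}$, $(A,B)$ stabilizable, and feedback gain $K\in\mathbb{R}^{m\times n}$ such that $A+BK$ is Schur stable. The random disturbance takes values in the box $\mathbb{W}=[\tilde w_1,\tilde w_2]\subset\mathbb{R}^n$. State constraint set: $\mathbb{X}=[\tilde x_1,\tilde x_2]\subset\mathbb{R}^n$. Tolerance level: $\varepsilon\in(0,1)$. Mixture model: for each coordinate $\tau$ and the current state $x_t$ one is given a finite Gaussian mixture (a learned predictive distribution of $w(x_t)^{(\tau)}$) with $M_\tau=M_\tau(x_t)$ components, component means $\mu_{\tau,j}(x_t)\in\mathbb{R}$, component variances $\Sigma_{\tau,j}(x_t)\ge0$, and mixture weights $\gamma_{\tau,t,j}>0$ with $\sum_{j}\gamma_{\tau,t,j}=1$. Ambiguity set of the disturbance: let $\mathcal{W}_{\tau,j}(x_t)$ be the set of nonnegative Borel measures $\rho$ on $\mathbb{R}$ supported on $[\tilde w_1^{(\tau)},\tilde w_2^{(\tau)}]$ with $\int\rho(d\xi)=1$, $\int\xi\,\rho(d\xi)=\mu_{\tau,j}(x_t)$ and $\int(\xi-\mu_{\tau,j}(x_t))^2\rho(d\xi)\le\Sigma_{\tau,j}(x_t)$. Define the weighted Minkowski sum $$\mathcal{W}_\tau(x_t)=\sum_{j=1}^{M_\tau}\gamma_{\tau,t,j}\mathcal{W}_{\tau,j}(x_t)=\left\{\sum_j\gamma_{\tau,t,j}\rho_j:\rho_j\in\mathcal{W}_{\tau,j}(x_t)\right\}.$$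 Ambiguity set of the next state: $x_{1|t}^{(\tau)}=z_t^{(\tau)}+w(x_t)^{(\tau)}$ with $z_t=s_{1|t}+(A+BK)(x_t-s_{0|t})$ deterministic, and $\mathcal{Q}_\tau(x_{1|t})$ is the shifted version of $\mathcal{W}_\tau(x_t)$, i.e. the set of laws of $z_t^{(\tau)}+\xi$ with $\xi\sim\mathbb{P}$, $\mathbb{P}\in\mathcal{W}_\tau(x_t)$. CVaR: for a loss $L$ under $\mathbb{Q}$, $\mathbb{Q}\text{-CVaR}_\varepsilon(L)=\inf_{\beta\in\mathbb{R}}\{\beta+\frac1\varepsilon\mathbb{E}_{\mathbb{Q}}[(L-\beta)^+]\}$, where $(a)^+=\max(a,0)$. Optimal values (infima) and suprema are understood in the extended reals, with the supremum over the empty set equal to $-\infty$. *)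

theory Defs
  imports "HOL-Probability.Probability"
begin

definition schur_stable :: "real^'n^'n \<Rightarrow> bool" where
  "schur_stable F \<longleftrightarrow>
     (\<forall>(l::complex) (v::complex^'n).
        v \<noteq> 0 \<and> map_matrix complex_of_real F *v v = l *s v \<longrightarrow> cmod l < 1)"

definition stabilizable :: "real^'n^'n \<Rightarrow> real^'m^'n \<Rightarrow> bool" where
  "stabilizable A B \<longleftrightarrow> (\<exists>F::real^'n^'m. schur_stable (A + B ** F))"

(* CVaR as an extended real. The expectation of the nonnegative excess is taken as an
   extended nonnegative integral, so that it is infinity, and not the default value 0 of the
   Bochner integral, if the excess is not integrable. *)
definition cvar :: "real \<Rightarrow> 'a measure \<Rightarrow> ('a \<Rightarrow> real) \<Rightarrow> ereal" where
  "cvar \<epsilon> Q L =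
     (INF \<beta>::real. ereal \<beta>
        + ereal (1 / \<epsilon>) * enn2ereal (\<integral>\<^sup>+ y. ennreal (max (L y - \<beta>) 0) \<partial>Q))"

(* "Supported on [a,b]" means that the complement of [a,b] is null (the interval is closed).
   Both integrands are then essentially bounded, so the Bochner integrals are genuine. *)
definition moment_ambiguity :: "real \<Rightarrow> real \<Rightarrow> real \<Rightarrow> real \<Rightarrow> real measure set" where
  "moment_ambiguity a b m s =
     {\<rho>. sets \<rho> = sets borel \<and> prob_space \<rho> \<and> emeasure \<rho> (- {a..b}) = 0 \<and>
         (\<integral>\<xi>. \<xi> \<partial>\<rho>) = m \<and> (\<integral>\<xi>. (\<xi> - m)\<^sup>2 \<partial>\<rho>) \<le> s}"

definition mixture_measure :: "nat \<Rightarrow> (nat \<Rightarrow> real) \<Rightarrow> (nat \<Rightarrow> real measure) \<Rightarrow> real measure" where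
  "mixture_measure M \<gamma> \<rho> =
     measure_of UNIV (sets borel) (\<lambda>S. \<Sum>j=1..M. ennreal (\<gamma> j) * emeasure (\<rho> j) S)"

lemma sets_mixture_measure [simp, measurable_cong]: "sets (mixture_measure M \<gamma> \<rho>) = sets borel"
  unfolding mixture_measure_def by (metis sets.sets_measure_of_eq space_borel)

lemma emeasure_mixture_measure:
  assumes "\<And>j. j \<in> {1..M} \<Longrightarrow> sets (\<rho> j) = sets borel" and "S \<in> sets borel"
  shows "emeasure (mixture_measure M \<gamma> \<rho>) S = (\<Sum>j=1..M. ennreal (\<gamma> j) * emeasure (\<rho> j) S)"
proof (rule emeasure_measure_of[OF mixture_measure_def])
  let ?f = "\<lambda>S. \<Sum>j=1..M. ennreal (\<gamma> j) * emeasure (\<rho> j) S"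
  show "countably_additive (sets (mixture_measure M \<gamma> \<rho>)) ?f"
  proof (rule countably_additiveI)
    fix X :: "nat \<Rightarrow> real set"
    assume X: "range X \<subseteq> sets (mixture_measure M \<gamma> \<rho>)" "disjoint_family X"
    have "(\<Sum>k. ?f (X k)) = (\<Sum>j=1..M. \<Sum>k. ennreal (\<gamma> j) * emeasure (\<rho> j) (X k))"
      by (rule suminf_sum) simp
    also have "\<dots> = ?f (\<Union>k. X k)"
      using X assms(1) by (intro sum.cong refl) (simp add: suminf_emeasure)
    finally show "(\<Sum>k. ?f (X k)) = ?f (\<Union>k. X k)" .
  qed
qed (use assms(2) in \<open>auto simp: positive_def\<close>)

definition disturbance_ambiguity ::
  "real \<Rightarrow> real \<Rightarrow> nat \<Rightarrow> (nat \<Rightarrow> real) \<Rightarrow> (nat \<Rightarrow> real) \<Rightarrow> (nat \<Rightarrow> real) \<Rightarrow> real measure set" where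
  "disturbance_ambiguity a b M \<gamma> \<mu> \<sigma> =
     {mixture_measure M \<gamma> \<rho> |\<rho>. \<forall>j\<in>{1..M}. \<rho> j \<in> moment_ambiguity a b (\<mu> j) (\<sigma> j)}"

definition shifted_ambiguity :: "real \<Rightarrow> real measure set \<Rightarrow> real measure set" where
  "shifted_ambiguity c W = {distr P borel (\<lambda>\<xi>. c + \<xi>) |P. P \<in> W}"

(* The Euclidean norm of a column (p, q) is the product norm of the pair; \<sigma> j is the
   variance of the j-th component. *)
definition socp_feasible ::
  "nat \<Rightarrow> real \<Rightarrow> real \<Rightarrow> real \<Rightarrow> nat \<Rightarrow> (nat \<Rightarrow> real) \<Rightarrow> (nat \<Rightarrow> real) \<Rightarrow> (nat \<Rightarrow> real) \<Rightarrow>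
   real \<Rightarrow> real \<Rightarrow> (nat \<Rightarrow> real) \<Rightarrow> (nat \<Rightarrow> real) \<Rightarrow> (nat \<Rightarrow> real) \<Rightarrow>
   (nat \<Rightarrow> real) \<Rightarrow> (nat \<Rightarrow> real) \<Rightarrow> (nat \<Rightarrow> real) \<Rightarrow> (nat \<Rightarrow> real) \<Rightarrow> bool" where
  "socp_feasible i \<epsilon> a b M \<gamma> \<mu> \<sigma> \<eta> \<beta> t \<omega> \<Omega> \<phi>1 \<phi>2 \<psi>1 \<psi>2 \<longleftrightarrow>
     \<epsilon> * \<beta> + (\<Sum>j=1..M. \<gamma> j * (t j + \<mu> j * \<omega> j + (\<sigma> j + (\<mu> j)\<^sup>2) * \<Omega> j)) \<le> 0 \<and>
     (\<forall>j\<in>{1..M}.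
        norm (\<omega> j + \<phi>1 j - \<phi>2 j, \<Omega> j - t j + b * \<phi>1 j - a * \<phi>2 j)
          \<le> \<Omega> j + t j - b * \<phi>1 j + a * \<phi>2 j \<and>
        norm (\<omega> j - (-1)^i + \<psi>1 j - \<psi>2 j, \<Omega> j - t j - \<beta> - \<eta> + b * \<psi>1 j - a * \<psi>2 j)
          \<le> \<Omega> j + t j + \<beta> + \<eta> - b * \<psi>1 j + a * \<psi>2 j \<and>
        \<Omega> j \<ge> 0 \<and> \<phi>1 j \<ge> 0 \<and> \<phi>2 j \<ge> 0 \<and> \<psi>1 j \<ge> 0 \<and> \<psi>2 j \<ge> 0)"

definition socp_value ::
  "nat \<Rightarrow> real \<Rightarrow> real \<Rightarrow> real \<Rightarrow> nat \<Rightarrow> (nat \<Rightarrow> real) \<Rightarrow> (nat \<Rightarrow> real) \<Rightarrow> (nat \<Rightarrow> real) \<Rightarrow> ereal" where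
  "socp_value i \<epsilon> a b M \<gamma> \<mu> \<sigma> =
     Inf {ereal \<eta> |\<eta>. \<exists>\<beta> t \<omega> \<Omega> \<phi>1 \<phi>2 \<psi>1 \<psi>2.
            socp_feasible i \<epsilon> a b M \<gamma> \<mu> \<sigma> \<eta> \<beta> t \<omega> \<Omega> \<phi>1 \<phi>2 \<psi>1 \<psi>2}"

definition ereal_vec :: "real^'n \<Rightarrow> ereal^'n" where
  "ereal_vec v = (\<chi> \<tau>. ereal (v $ \<tau>))"

end

(* The worst case over the moment sets does not change if the component laws are restricted to
   two-point laws: splitting each component law into its CVaR tail (mass p) and the rest, and replacing both
   parts by their barycentres, keeps the mean and does not increase the variance. The admissible
   pairs (p, tail excess) of a component form a convex set, and the components interact only through
   the budget "sum of gamma_j p_j = epsilon". A Lagrange multiplier for this scalar budget is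
   the CVaR threshold, and it decouples the problem into one-component moment problems. These are
   solved dually by explicit convex quadratics majorising the hinge function on the support (Scarf's
   bound, and its variants touching an endpoint). The second-order cone constraints say
   exactly that such quadratics are nonnegative on an interval. *)
theory Submission
  imports Defs
begin

text \<open>The splitting into tail and rest explains why two-point laws suffice, but it is never
  applied to a general law: the quadratics bound every law from above, the two-point laws are used
  only from below, and the two bounds meet. Keeping one atom of mass p bounds the expected excess
  below by an affine function of the threshold. Once the masses exhaust the budget, the threshold
  cancels, so a single lower bound holds for the whole infimum in CVaR and no minimax theorem is
  needed. The cone program is the CVaR formula in other variables. The majorants see only the
  threshold \<open>\<beta> + \<eta>\<close>; for a fixed threshold, the budget row forces \<eta> to
  be at least this threshold plus 1/\<epsilon> times the weighted moment bounds. No optimum is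
  assumed to be attained: suprema are approached up to a positive slack, which vanishes only in the
  final comparison of extended reals.\<close>

section \<open>Second-order cones and quadratics nonnegative on an interval\<close>

text \<open>Squaring leaves \<open>p\<^sup>2 \<le> 4 * \<Omega> * t\<close> with
  \<open>\<Omega> + t\<close> nonnegative: the symmetric matrix with diagonal
  \<open>\<Omega>\<close>, \<open>t\<close> and off-diagonal entry \<open>p / 2\<close> is positive
  semidefinite.\<close>

lemma soc_iff_nonneg:
  fixes \<Omega> p t :: real
  assumes "\<Omega> \<ge> 0"
  shows "norm (p, \<Omega> - t) \<le> \<Omega> + t \<longleftrightarrow> (\<forall>x. 0 \<le> \<Omega> * x\<^sup>2 + p * x + t)"
proof -
  have "norm (p, \<Omega> - t) \<le> \<Omega> + t \<longleftrightarrow> 0 \<le> \<Omega> + t \<and> p\<^sup>2 + (\<Omega> - t)\<^sup>2 \<le> (\<Omega> + t)\<^sup>2"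
    by (simp add: norm_Pair) (meson order_trans real_le_lsqrt real_sqrt_ge_zero sqrt_le_D
        sum_power2_ge_zero)
  also have "\<dots> \<longleftrightarrow> 0 \<le> \<Omega> + t \<and> p\<^sup>2 \<le> 4 * \<Omega> * t"
    by (simp add: power2_eq_square algebra_simps)
  also have "\<dots> \<longleftrightarrow> (\<forall>x. 0 \<le> \<Omega> * x\<^sup>2 + p * x + t)"
  proof (cases "\<Omega> = 0")
    case True
    \<comment> \<open>At the chosen point \<open>p * x + t\<close> equals \<open>-1\<close>, which
      excludes a nonzero slope.\<close>
    have "p = 0" if *: "\<And>x. 0 \<le> p * x + t"
      using *[of "- (t + 1) / p"] by (cases "p = 0") auto
    then show ?thesis using True by force
  next
    case False
    with assms have pos: "\<Omega> > 0" by simp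
    have id: "4 * \<Omega> * (\<Omega> * x\<^sup>2 + p * x + t) = (2 * \<Omega> * x + p)\<^sup>2 + (4 * \<Omega> * t - p\<^sup>2)" for x
      by (simp add: power2_eq_square algebra_simps)
    show ?thesis
    proof (intro iffI allI conjI)
      fix x assume "0 \<le> \<Omega> + t \<and> p\<^sup>2 \<le> 4 * \<Omega> * t"
      then have "0 \<le> 4 * \<Omega> * (\<Omega> * x\<^sup>2 + p * x + t)" unfolding id by simp
      then show "0 \<le> \<Omega> * x\<^sup>2 + p * x + t" using pos by (simp add: zero_le_mult_iff)
    next
      assume nonneg: "\<forall>x. 0 \<le> \<Omega> * x\<^sup>2 + p * x + t"
      from nonneg[rule_format, of 0] pos show "0 \<le> \<Omega> + t" by simp
      define y where "y = - p / (2 * \<Omega>)"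
      have "0 \<le> 4 * \<Omega> * (\<Omega> * y\<^sup>2 + p * y + t)"
        using nonneg[rule_format, of y] pos by simp
      then show "p\<^sup>2 \<le> 4 * \<Omega> * t" unfolding id using pos by (simp add: y_def)
    qed
  qed
  finally show ?thesis .
qed

text \<open>Lagrange duality for minimising a convex quadratic over an interval:
  \<open>\<phi>1\<close> and \<open>\<phi>2\<close> are the multipliers of
  \<open>b - x \<ge> 0\<close> and \<open>x - a \<ge> 0\<close>, and the right-hand side says that
  the Lagrangian is nonnegative everywhere.\<close>

lemma quadratic_nonneg_interval:
  fixes \<Omega> p t a b :: real
  assumes "\<Omega> \<ge> 0" "a \<le> b"
  shows "(\<forall>x\<in>{a..b}. 0 \<le> \<Omega> * x\<^sup>2 + p * x + t) \<longleftrightarrow>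
    (\<exists>\<phi>1\<ge>0. \<exists>\<phi>2\<ge>0. \<forall>x. 0 \<le> \<Omega> * x\<^sup>2 + (p + \<phi>1 - \<phi>2) * x + (t - b * \<phi>1 + a * \<phi>2))"
    (is "?L \<longleftrightarrow> ?R")
proof
  have id: "\<Omega> * x\<^sup>2 + (p + \<phi>1 - \<phi>2) * x + (t - b * \<phi>1 + a * \<phi>2)
      = \<Omega> * x\<^sup>2 + p * x + t - \<phi>1 * (b - x) - \<phi>2 * (x - a)" for x \<phi>1 \<phi>2
    by (simp add: algebra_simps)
  {
    assume ?R
    then obtain \<phi>1 \<phi>2 where "\<phi>1 \<ge> 0" "\<phi>2 \<ge> 0"
      and *: "\<And>x. 0 \<le> \<Omega> * x\<^sup>2 + p * x + t - \<phi>1 * (b - x) - \<phi>2 * (x - a)"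
      unfolding id by blast
    then have "0 \<le> \<phi>1 * (b - x)" "0 \<le> \<phi>2 * (x - a)" if "x \<in> {a..b}" for x
      using that by auto
    with * show ?L by (smt (verit))
  }
  assume L: ?L
  have split: "\<Omega> * x\<^sup>2 + p * x + t
      = (\<Omega> * y\<^sup>2 + p * y + t) + (2 * \<Omega> * y + p) * (x - y) + \<Omega> * (x - y)\<^sup>2" for x y
    by (simp add: power2_eq_square algebra_simps)
  \<comment> \<open>The minimiser over the interval is the right end, the left end or an interior
    vertex. The slope there gives the multiplier, and expanding about that point leaves the minimum
    plus a square.\<close>
  consider "2 * \<Omega> * b + p \<le> 0" | "2 * \<Omega> * a + p \<ge> 0"
    | "2 * \<Omega> * a + p < 0" "0 < 2 * \<Omega> * b + p" by linarith
  then show ?R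
  proof cases
    case 1
    have eq: "\<Omega> * x\<^sup>2 + p * x + t - (- (2 * \<Omega> * b + p)) * (b - x) - 0 * (x - a)
        = (\<Omega> * b\<^sup>2 + p * b + t) + \<Omega> * (x - b)\<^sup>2" for x
      by (simp add: power2_eq_square algebra_simps)
    have "0 \<le> \<Omega> * x\<^sup>2 + p * x + t - (- (2 * \<Omega> * b + p)) * (b - x) - 0 * (x - a)" for x
      unfolding eq using L[rule_format, of b] assms by simp
    with 1 show ?thesis unfolding id by (metis neg_0_le_iff_le order_refl)
  next
    case 2
    have eq: "\<Omega> * x\<^sup>2 + p * x + t - 0 * (b - x) - (2 * \<Omega> * a + p) * (x - a)
        = (\<Omega> * a\<^sup>2 + p * a + t) + \<Omega> * (x - a)\<^sup>2" for x
      by (simp add: power2_eq_square algebra_simps)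
    have "0 \<le> \<Omega> * x\<^sup>2 + p * x + t - 0 * (b - x) - (2 * \<Omega> * a + p) * (x - a)" for x
      unfolding eq using L[rule_format, of a] assms by simp
    with 2 show ?thesis unfolding id by (metis order_refl)
  next
    case 3
    then have "\<Omega> \<noteq> 0" by auto
    with assms have pos: "\<Omega> > 0" by simp
    define y where "y = - p / (2 * \<Omega>)"
    have y: "2 * \<Omega> * y + p = 0" "y \<in> {a..b}"
      using 3 pos by (auto simp: y_def field_simps)
    have "0 \<le> \<Omega> * x\<^sup>2 + p * x + t - 0 * (b - x) - 0 * (x - a)" for x
      unfolding split[of x y] using L y assms(1) by simp
    then show ?thesis unfolding id by (metis order_refl)
  qed
qed

text \<open>The first cone puts the quadratic above 0 on the support, the second above the loss
  minus \<open>\<beta> + \<eta>\<close>; together they majorise the hinge. The eliminated variables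
  are the interval multipliers, chosen separately for each \<open>j\<close>.\<close>

lemma socp_feasible_iff:
  assumes "a \<le> b"
  shows "(\<exists>\<phi>1 \<phi>2 \<psi>1 \<psi>2. socp_feasible i \<epsilon> a b M \<gamma> \<mu> \<sigma> \<eta> \<beta> t \<omega> \<Omega> \<phi>1 \<phi>2 \<psi>1 \<psi>2) \<longleftrightarrow>
    \<epsilon> * \<beta> + (\<Sum>j=1..M. \<gamma> j * (t j + \<mu> j * \<omega> j + (\<sigma> j + (\<mu> j)\<^sup>2) * \<Omega> j)) \<le> 0 \<and>
    (\<forall>j\<in>{1..M}. \<Omega> j \<ge> 0 \<and>
      (\<forall>\<xi>\<in>{a..b}. max 0 ((-1)^i * \<xi> - (\<beta> + \<eta>)) \<le> \<Omega> j * \<xi>\<^sup>2 + \<omega> j * \<xi> + t j))"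
proof -
  let ?soc = "\<lambda>p \<Omega> t \<phi>1 \<phi>2. norm (p + \<phi>1 - \<phi>2, \<Omega> - (t - b * \<phi>1 + a * \<phi>2))
      \<le> \<Omega> + (t - b * \<phi>1 + a * \<phi>2)"
  have soc: "\<Omega> \<ge> 0 \<Longrightarrow> (\<exists>\<phi>1\<ge>0. \<exists>\<phi>2\<ge>0. ?soc p \<Omega> t \<phi>1 \<phi>2) \<longleftrightarrow>
      (\<forall>\<xi>\<in>{a..b}. 0 \<le> \<Omega> * \<xi>\<^sup>2 + p * \<xi> + t)" for p \<Omega> t
    using assms by (simp add: soc_iff_nonneg quadratic_nonneg_interval)
  have "(\<exists>\<phi>1 \<phi>2 \<psi>1 \<psi>2. socp_feasible i \<epsilon> a b M \<gamma> \<mu> \<sigma> \<eta> \<beta> t \<omega> \<Omega> \<phi>1 \<phi>2 \<psi>1 \<psi>2) \<longleftrightarrow>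
    \<epsilon> * \<beta> + (\<Sum>j=1..M. \<gamma> j * (t j + \<mu> j * \<omega> j + (\<sigma> j + (\<mu> j)\<^sup>2) * \<Omega> j)) \<le> 0 \<and>
    (\<exists>\<phi>1 \<phi>2 \<psi>1 \<psi>2. \<forall>j\<in>{1..M}. \<Omega> j \<ge> 0 \<and> \<phi>1 j \<ge> 0 \<and> \<phi>2 j \<ge> 0 \<and> \<psi>1 j \<ge> 0 \<and> \<psi>2 j \<ge> 0 \<and>
      ?soc (\<omega> j) (\<Omega> j) (t j) (\<phi>1 j) (\<phi>2 j) \<and>
      ?soc (\<omega> j - (-1)^i) (\<Omega> j) (t j + \<beta> + \<eta>) (\<psi>1 j) (\<psi>2 j))"
    unfolding socp_feasible_def by (simp add: algebra_simps conj_ac)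
  also have "\<dots> \<longleftrightarrow> \<epsilon> * \<beta> + (\<Sum>j=1..M. \<gamma> j * (t j + \<mu> j * \<omega> j + (\<sigma> j + (\<mu> j)\<^sup>2) * \<Omega> j)) \<le> 0 \<and>
    (\<forall>j\<in>{1..M}. \<Omega> j \<ge> 0 \<and> (\<exists>\<phi>1\<ge>0. \<exists>\<phi>2\<ge>0. ?soc (\<omega> j) (\<Omega> j) (t j) \<phi>1 \<phi>2) \<and>
      (\<exists>\<psi>1\<ge>0. \<exists>\<psi>2\<ge>0. ?soc (\<omega> j - (-1)^i) (\<Omega> j) (t j + \<beta> + \<eta>) \<psi>1 \<psi>2))"
    (is "?S \<and> ?X \<longleftrightarrow> ?S \<and> (\<forall>j\<in>_. ?Y j)")
  proof (rule conj_cong[OF refl], rule iffI)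
    assume "\<forall>j\<in>{1..M}. ?Y j"
    then have "\<forall>j. \<exists>\<phi>1 \<phi>2 \<psi>1 \<psi>2. j \<in> {1..M} \<longrightarrow> \<Omega> j \<ge> 0 \<and> \<phi>1 \<ge> 0 \<and> \<phi>2 \<ge> 0 \<and> \<psi>1 \<ge> 0 \<and> \<psi>2 \<ge> 0 \<and>
      ?soc (\<omega> j) (\<Omega> j) (t j) \<phi>1 \<phi>2 \<and> ?soc (\<omega> j - (-1)^i) (\<Omega> j) (t j + \<beta> + \<eta>) \<psi>1 \<psi>2"
      by blast
    then show ?X unfolding choice_iff by blast
  qed blast
  also have "\<dots> \<longleftrightarrow> \<epsilon> * \<beta> + (\<Sum>j=1..M. \<gamma> j * (t j + \<mu> j * \<omega> j + (\<sigma> j + (\<mu> j)\<^sup>2) * \<Omega> j)) \<le> 0 \<and>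
    (\<forall>j\<in>{1..M}. \<Omega> j \<ge> 0 \<and>
      (\<forall>\<xi>\<in>{a..b}. max 0 ((-1)^i * \<xi> - (\<beta> + \<eta>)) \<le> \<Omega> j * \<xi>\<^sup>2 + \<omega> j * \<xi> + t j))"
  proof (intro conj_cong refl ball_cong)
    fix j assume "\<Omega> j \<ge> 0"
    have "0 \<le> \<Omega> j * \<xi>\<^sup>2 + (\<omega> j - (-1)^i) * \<xi> + (t j + \<beta> + \<eta>) \<longleftrightarrow>
      (-1)^i * \<xi> - (\<beta> + \<eta>) \<le> \<Omega> j * \<xi>\<^sup>2 + \<omega> j * \<xi> + t j" for \<xi>
      by (simp add: algebra_simps)
    then show "((\<exists>\<phi>1\<ge>0. \<exists>\<phi>2\<ge>0. ?soc (\<omega> j) (\<Omega> j) (t j) \<phi>1 \<phi>2) \<and>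
      (\<exists>\<psi>1\<ge>0. \<exists>\<psi>2\<ge>0. ?soc (\<omega> j - (-1)^i) (\<Omega> j) (t j + \<beta> + \<eta>) \<psi>1 \<psi>2)) \<longleftrightarrow>
      (\<forall>\<xi>\<in>{a..b}. max 0 ((-1)^i * \<xi> - (\<beta> + \<eta>)) \<le> \<Omega> j * \<xi>\<^sup>2 + \<omega> j * \<xi> + t j)"
      unfolding soc[OF \<open>\<Omega> j \<ge> 0\<close>] by (auto simp: max_def)
  qed
  finally show ?thesis .
qed

section \<open>Quadratic majorants of the hinge function\<close>

text \<open>The extremal centred law of variance \<open>v\<close> has atoms \<open>B\<close> and
  \<open>- v / B\<close>. The majorant has a double zero at the second atom and meets the line
  \<open>x - l\<close> at \<open>B\<close>. The last hypothesis says that its slope at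
  \<open>B\<close> is at most 1, so that it stays above the line to the left of
  \<open>B\<close>.\<close>

lemma endpoint_majorant:
  fixes B v l :: real
  assumes "B > 0" "v \<ge> 0" "l \<le> B" "(B - l)\<^sup>2 \<le> v + l\<^sup>2"
  shows "\<exists>\<Omega>\<ge>0. \<exists>\<omega> t. (\<forall>x\<le>B. max 0 (x - l) \<le> \<Omega> * x\<^sup>2 + \<omega> * x + t) \<and>
    t + v * \<Omega> = (B - l) * v / (B\<^sup>2 + v)"
proof -
  define c where "c = v / B"
  have c: "c \<ge> 0" "v = c * B" using assms by (auto simp: c_def)
  \<comment> \<open>Scaled so that the parabola with double zero at \<open>-c\<close> takes the
    value \<open>B - l\<close> at \<open>B\<close>.\<close>
  define \<Omega> where "\<Omega> = (B - l) / (B + c)\<^sup>2"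
  have \<Omega>: "\<Omega> \<ge> 0" "\<Omega> * (B + c)\<^sup>2 = B - l" using assms c by (auto simp: \<Omega>_def)
  have "B * (B - 2 * l) \<le> B * c" using assms c by (simp add: power2_eq_square algebra_simps)
  then have "2 * (B - l) \<le> B + c" using assms by simp
  moreover have "2 * \<Omega> * (B + c) = 2 * (B - l) / (B + c)"
    using assms c by (simp add: \<Omega>_def power2_eq_square)
  ultimately have slope: "2 * \<Omega> * (B + c) \<le> 1" using assms c by simp
  have "max 0 (x - l) \<le> \<Omega> * (x + c)\<^sup>2" if "x \<le> B" for x
  proof -
    have "\<Omega> * (x + c)\<^sup>2 = \<Omega> * (B + c)\<^sup>2 - 2 * \<Omega> * (B + c) * (B - x) + \<Omega> * (B - x)\<^sup>2"
      by (simp add: power2_eq_square algebra_simps)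
    also have "\<dots> \<ge> (B - l) - 1 * (B - x) + 0"
      unfolding \<Omega>(2) using that slope \<Omega>(1)
      by (intro add_mono diff_mono mult_right_mono) auto
    finally show ?thesis using \<Omega>(1) by auto
  qed
  then have "\<forall>x\<le>B. max 0 (x - l) \<le> \<Omega> * x\<^sup>2 + (2 * \<Omega> * c) * x + \<Omega> * c\<^sup>2"
    by (simp add: power2_eq_square algebra_simps)
  moreover have "\<Omega> * c\<^sup>2 + v * \<Omega> = (B - l) * v / (B\<^sup>2 + v)"
  proof -
    have "\<Omega> * c\<^sup>2 + v * \<Omega> = \<Omega> * (B + c) * c" by (simp add: c power2_eq_square algebra_simps)
    also have "\<dots> = (B - l) * c / (B + c)"
      using assms c by (simp add: \<Omega>_def power2_eq_square)
    also have "\<dots> = (B - l) * v / (B\<^sup>2 + v)"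
    proof -
      have "B\<^sup>2 + v = (B + c) * B" by (simp add: c(2) power2_eq_square algebra_simps)
      then show ?thesis using assms c by simp
    qed
    finally show ?thesis .
  qed
  ultimately show ?thesis using \<Omega>(1) by blast
qed

text \<open>The slack \<open>\<delta>\<close> is needed: for \<open>v = 0\<close>, \<open>l = 0\<close> and \<open>A, B > 0\<close> one has \<open>D = 0\<close>, but every quadratic
  above the hinge function is positive at its kink.\<close>

lemma centred_quadratic_majorant:
  fixes A B v l D \<delta> :: real
  assumes "A \<ge> 0" "B \<ge> 0" "v \<ge> 0" "\<delta> > 0"
    and D: "\<And>p y. \<lbrakk>0 \<le> p; p \<le> 1; 0 \<le> y; y \<le> p * B; y \<le> (1 - p) * A; y\<^sup>2 \<le> v * p * (1 - p)\<rbrakk>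
      \<Longrightarrow> y - l * p \<le> D"
  shows "\<exists>\<Omega>\<ge>0. \<exists>\<omega> t. (\<forall>x\<in>{-A..B}. max 0 (x - l) \<le> \<Omega> * x\<^sup>2 + \<omega> * x + t) \<and>
    t + v * \<Omega> \<le> D + \<delta>"
proof -
  define R where "R = sqrt (v + l\<^sup>2)"
  have R: "R \<ge> 0" "R\<^sup>2 = v + l\<^sup>2" "\<bar>l\<bar> \<le> R"
    using assms by (auto simp: R_def intro: real_le_rsqrt)
  have D0: "0 \<le> D" using D[of 0 0] assms by simp
  \<comment> \<open>Scarf's extremal law has atoms \<open>l - R\<close> and \<open>l + R\<close>; in
    the last case both lie inside the support. In cases 4 and 5 one of them leaves it and is
    replaced by an endpoint. In case 3 the law on the two endpoints already respects the variance
    bound; in cases 1 and 2 the hinge is affine on the support. Only the degenerate case 6 spends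
    \<open>\<delta>\<close>.\<close>
  consider "l \<ge> B" | "l \<le> - A" | "-A < l" "l < B" "A * B \<le> v"
    | "-A < l" "l < B" "v < A * B" "B - l \<le> R" | "-A < l" "l < B" "v < A * B" "l + A \<le> R"
    | "R < B - l" "R < l + A" "R = 0" | "R < B - l" "R < l + A" "R > 0"
    using R by linarith
  then show ?thesis
  proof cases
    case 1
    then have "(\<forall>x\<in>{-A..B}. max 0 (x - l) \<le> 0 * x\<^sup>2 + 0 * x + 0) \<and> 0 + v * 0 \<le> D + \<delta>"
      using D0 assms by auto
    then show ?thesis by (meson order_refl)
  next
    case 2
    then have "(\<forall>x\<in>{-A..B}. max 0 (x - l) \<le> 0 * x\<^sup>2 + 1 * x + (-l)) \<and> (-l) + v * 0 \<le> D + \<delta>"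
      using D[of 1 0] assms by auto
    then show ?thesis by (meson order_refl)
  next
    case 3
    have AB: "A + B > 0" using 3 by linarith
    \<comment> \<open>The majorant is the chord of the convex hinge over the whole support. The
      matching law has mass \<open>A / (A + B)\<close> at \<open>B\<close> and variance
      \<open>A * B\<close>.\<close>
    define t where "t = A * (B - l) / (A + B)"
    have "max 0 (x - l) \<le> (B - l) / (A + B) * x + t" if "x \<in> {-A..B}" for x
    proof -
      have "(B - l) / (A + B) * x + t = (B - l) * (x + A) / (A + B)"
        "(B - l) / (A + B) * x + t - (x - l) = (l + A) * (B - x) / (A + B)"
        using AB unfolding t_def by (simp_all add: divide_simps) (simp_all add: algebra_simps)
      moreover have "0 \<le> (B - l) * (x + A) / (A + B)" "0 \<le> (l + A) * (B - x) / (A + B)"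
        using that 3 AB by auto
      ultimately show ?thesis by simp
    qed
    moreover have "t \<le> D"
    proof -
      have "(A * B / (A + B))\<^sup>2 = (A * B) * (A / (A + B) * (B / (A + B)))"
        by (simp add: power2_eq_square)
      also have "\<dots> \<le> v * (A / (A + B) * (B / (A + B)))"
        using 3 assms by (intro mult_right_mono) auto
      also have "B / (A + B) = 1 - A / (A + B)" using AB by (simp add: divide_simps)
      finally have "A * B / (A + B) - l * (A / (A + B)) \<le> D"
        using AB assms by (intro D) (auto simp: field_simps)
      then show ?thesis by (simp add: t_def algebra_simps diff_divide_distrib)
    qed
    ultimately have "(\<forall>x\<in>{-A..B}. max 0 (x - l) \<le> 0 * x\<^sup>2 + (B - l) / (A + B) * x + t) \<and>
      t + v * 0 \<le> D + \<delta>" using assms by simp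
    then show ?thesis by (meson order_refl)
  next
    case 4
    then have "A > 0" "B > 0"
      using assms by (metis mult_zero_left mult_zero_right not_le order_le_less)+
    have "(B - l)\<^sup>2 \<le> v + l\<^sup>2" using 4 R(2) by (smt (verit) power_mono)
    then obtain \<Omega> \<omega> t where *: "\<Omega> \<ge> 0" "\<And>x. x \<le> B \<Longrightarrow> max 0 (x - l) \<le> \<Omega> * x\<^sup>2 + \<omega> * x + t"
      "t + v * \<Omega> = (B - l) * v / (B\<^sup>2 + v)"
      using endpoint_majorant[of B v l] 4 assms \<open>B > 0\<close> by auto
    \<comment> \<open>The mass at \<open>B\<close> in the extremal law. Its other atom
      \<open>- v / B\<close> stays in the support because \<open>v < A * B\<close>.\<close>
    define p where "p = v / (B\<^sup>2 + v)"
    have pos: "B\<^sup>2 + v > 0" using \<open>B > 0\<close> assms by (simp add: add_pos_nonneg)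
    have q: "1 - p = B\<^sup>2 / (B\<^sup>2 + v)" using pos by (simp add: p_def divide_simps)
    have "p * B - l * p \<le> D"
    proof (rule D)
      show "0 \<le> p" "p \<le> 1" "0 \<le> p * B" using pos assms by (auto simp: p_def)
      have "v * B \<le> A * B * B" using 4 \<open>B > 0\<close> by (intro mult_right_mono) auto
      then show "p * B \<le> (1 - p) * A"
        unfolding q using pos by (simp add: p_def power2_eq_square divide_right_mono mult_ac)
      show "(p * B)\<^sup>2 \<le> v * p * (1 - p)"
        unfolding q by (simp add: p_def power2_eq_square mult_ac)
    qed simp
    then have "t + v * \<Omega> \<le> D + \<delta>"
      using assms unfolding * by (simp add: p_def algebra_simps diff_divide_distrib)
    moreover have "\<forall>x\<in>{-A..B}. max 0 (x - l) \<le> \<Omega> * x\<^sup>2 + \<omega> * x + t"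
      by (intro ballI *(2)) simp
    ultimately show ?thesis using *(1) by blast
  next
    case 5
    then have "A > 0" "B > 0"
      using assms by (metis mult_zero_left mult_zero_right not_le order_le_less)+
    have "(A - (- l))\<^sup>2 \<le> v + (- l)\<^sup>2" using 5 R(2) by (smt (verit) power_mono power2_minus)
    \<comment> \<open>Reflection: the hinge at \<open>x\<close> is \<open>x - l\<close> plus the
      hinge with threshold \<open>-l\<close> at \<open>-x\<close>. The left end becomes a right end,
      and the added line explains \<open>1 - \<omega>\<close> and \<open>t - l\<close>
      below.\<close>
    then obtain \<Omega> \<omega> t where *: "\<Omega> \<ge> 0" "\<And>x. x \<le> A \<Longrightarrow> max 0 (x - (-l)) \<le> \<Omega> * x\<^sup>2 + \<omega> * x + t"
      "t + v * \<Omega> = (A - (-l)) * v / (A\<^sup>2 + v)"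
      using endpoint_majorant[of A v "-l"] 5 assms \<open>A > 0\<close> by auto
    define p where "p = A\<^sup>2 / (A\<^sup>2 + v)"
    have pos: "A\<^sup>2 + v > 0" using \<open>A > 0\<close> assms by (simp add: add_pos_nonneg)
    have q: "1 - p = v / (A\<^sup>2 + v)" using pos by (simp add: p_def divide_simps)
    have "(1 - p) * A - l * p \<le> D"
    proof (rule D)
      show "0 \<le> p" "p \<le> 1" using pos assms by (auto simp: p_def)
      show "0 \<le> (1 - p) * A" unfolding q using pos assms by auto
      have "v * A \<le> A * B * A" using 5 \<open>A > 0\<close> by (intro mult_right_mono) auto
      then show "(1 - p) * A \<le> p * B"
        unfolding q using pos by (simp add: p_def power2_eq_square divide_right_mono mult_ac)
      show "((1 - p) * A)\<^sup>2 \<le> v * p * (1 - p)"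
        unfolding q by (simp add: p_def power2_eq_square mult_ac)
    qed simp
    moreover have "(1 - p) * A - l * p = (t + v * \<Omega>) - l"
      unfolding * q p_def using pos by (simp add: divide_simps) (simp add: algebra_simps)
    ultimately have "(t - l) + v * \<Omega> \<le> D + \<delta>" using assms by simp
    moreover have "\<forall>x\<in>{-A..B}. max 0 (x - l) \<le> \<Omega> * x\<^sup>2 + (1 - \<omega>) * x + (t - l)"
    proof
      fix x assume "x \<in> {-A..B}"
      then show "max 0 (x - l) \<le> \<Omega> * x\<^sup>2 + (1 - \<omega>) * x + (t - l)"
        using *(2)[of "-x"] by (simp add: algebra_simps)
    qed
    ultimately show ?thesis using * by blast
  next
    case 6
    with R have "l = 0" "v = 0" using assms by auto
    \<comment> \<open>The parabola of case 7 with \<open>\<delta>\<close> in place of the vanishing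
      \<open>R\<close>; its value at the mean is \<open>\<delta> / 4\<close>.\<close>
    have "max 0 x \<le> 1 / (4 * \<delta>) * x\<^sup>2 + 1 / 2 * x + \<delta> / 4" for x
    proof -
      have "1 / (4 * \<delta>) * x\<^sup>2 + 1 / 2 * x + \<delta> / 4 = (x + \<delta>)\<^sup>2 / (4 * \<delta>)"
        "1 / (4 * \<delta>) * x\<^sup>2 + 1 / 2 * x + \<delta> / 4 - x = (x - \<delta>)\<^sup>2 / (4 * \<delta>)"
        using assms by (simp_all add: power2_eq_square divide_simps) (simp_all add: algebra_simps)
      moreover have "0 \<le> (x + \<delta>)\<^sup>2 / (4 * \<delta>)" "0 \<le> (x - \<delta>)\<^sup>2 / (4 * \<delta>)" using assms by auto
      ultimately show ?thesis by (simp only: max_def) (smt (verit))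
    qed
    moreover have "\<delta> / 4 + v * (1 / (4 * \<delta>)) \<le> D + \<delta>" using D0 assms \<open>v = 0\<close> by simp
    moreover have "0 \<le> 1 / (4 * \<delta>)" using assms by simp
    ultimately show ?thesis unfolding \<open>l = 0\<close> diff_zero by blast
  next
    case 7
    \<comment> \<open>Coefficients of \<open>(x - l + R)\<^sup>2 / (4 * R)\<close>, which is tangent
      to 0 at \<open>l - R\<close> and to \<open>x - l\<close> at \<open>l + R\<close>.\<close>
    define \<Omega> \<omega> t where "\<Omega> = 1 / (4 * R)" and "\<omega> = (R - l) / (2 * R)" and "t = (R - l)\<^sup>2 / (4 * R)"
    have "max 0 (x - l) \<le> \<Omega> * x\<^sup>2 + \<omega> * x + t" for x
    proof -
      have "\<Omega> * x\<^sup>2 + \<omega> * x + t = (x - l + R)\<^sup>2 / (4 * R)"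
        "\<Omega> * x\<^sup>2 + \<omega> * x + t - (x - l) = (x - l - R)\<^sup>2 / (4 * R)"
        using 7 unfolding \<Omega>_def \<omega>_def t_def
        by (simp_all add: power2_eq_square divide_simps) (simp_all add: algebra_simps)
      moreover have "0 \<le> (x - l + R)\<^sup>2 / (4 * R)" "0 \<le> (x - l - R)\<^sup>2 / (4 * R)" using 7 by auto
      ultimately show ?thesis by (simp only: max_def) (smt (verit))
    qed
    moreover have "t + v * \<Omega> \<le> D"
    proof -
      define p where "p = (R - l) / (2 * R)"
      have v: "v = (R - l) * (R + l)" using R by (simp add: power2_eq_square algebra_simps)
      have q: "1 - p = (R + l) / (2 * R)" using 7 by (simp add: p_def divide_simps)
      have pq: "0 \<le> p" "0 \<le> 1 - p" using R 7 by (auto simp: p_def q)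
      have y: "p * (R + l) = (1 - p) * (R - l)" unfolding q by (simp add: p_def)
      have "t + v * \<Omega> = p * (R + l) - l * p"
        unfolding v \<Omega>_def t_def p_def using 7
        by (simp add: power2_eq_square divide_simps) (simp add: algebra_simps)
      also have "\<dots> \<le> D"
      proof (rule D)
        show "0 \<le> p * (R + l)" using pq R by auto
        show "p * (R + l) \<le> p * B" using pq 7 by (intro mult_left_mono) auto
        show "p * (R + l) \<le> (1 - p) * A" unfolding y using pq 7 by (intro mult_left_mono) auto
        have "(p * (R + l))\<^sup>2 = (p * (R + l)) * ((1 - p) * (R - l))"
          using y by (simp add: power2_eq_square)
        then show "(p * (R + l))\<^sup>2 \<le> v * p * (1 - p)" unfolding v by (simp add: mult_ac)
      qed (use pq in auto)
      finally show ?thesis .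
    qed
    moreover have "\<Omega> \<ge> 0" using 7 by (simp add: \<Omega>_def)
    ultimately show ?thesis using assms
      by (intro exI[of _ \<Omega>] conjI exI[of _ \<omega>] exI[of _ t]) auto
  qed
qed

text \<open>A pair \<open>(p, y)\<close> stands for the law with mass \<open>p\<close> at \<open>m + s * y / p\<close> and mass \<open>1 - p\<close> at
  \<open>m - s * y / (1 - p)\<close>; the conditions are multiplied by the masses, which makes them convex in
  \<open>(p, y)\<close> and harmless at \<open>p = 0\<close> and \<open>p = 1\<close>.\<close>

definition moment_pairs :: "real \<Rightarrow> real \<Rightarrow> real \<Rightarrow> real \<Rightarrow> real \<Rightarrow> (real \<times> real) set" where
  "moment_pairs s a b m v =
     {(p, y). 0 \<le> p \<and> p \<le> 1 \<and> 0 \<le> y \<and> y\<^sup>2 \<le> v * p * (1 - p) \<and>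
        p * m + s * y \<in> {p * a..p * b} \<and> (1 - p) * m - s * y \<in> {(1 - p) * a..(1 - p) * b}}"

text \<open>Strong duality for one component, up to \<open>\<delta>\<close>. The substitution
  \<open>x = s * (\<xi> - m)\<close> centres the law and turns both signs of the loss into an upward
  hinge with threshold \<open>lam - s * m\<close>.\<close>

lemma quadratic_majorant:
  fixes s a b m v lam D \<delta> :: real
  assumes s: "s = 1 \<or> s = -1" and "m \<in> {a..b}" "v \<ge> 0" "\<delta> > 0"
    and D: "\<And>p y. (p, y) \<in> moment_pairs s a b m v \<Longrightarrow> s * m * p + y - lam * p \<le> D"
  shows "\<exists>\<Omega> \<omega> t. \<Omega> \<ge> 0 \<and> (\<forall>\<xi>\<in>{a..b}. max 0 (s * \<xi> - lam) \<le> \<Omega> * \<xi>\<^sup>2 + \<omega> * \<xi> + t) \<and>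
    t + m * \<omega> + (v + m\<^sup>2) * \<Omega> \<le> D + \<delta>"
proof -
  define A where "A = (if s = 1 then m - a else b - m)"
  define B where "B = (if s = 1 then b - m else m - a)"
  have "\<exists>\<Omega>\<ge>0. \<exists>\<omega> t. (\<forall>x\<in>{-A..B}. max 0 (x - (lam - s * m)) \<le> \<Omega> * x\<^sup>2 + \<omega> * x + t) \<and>
    t + v * \<Omega> \<le> D + \<delta>"
  proof (rule centred_quadratic_majorant)
    fix p y assume py: "0 \<le> p" "p \<le> 1" "0 \<le> y" "y \<le> p * B" "y \<le> (1 - p) * A" "y\<^sup>2 \<le> v * p * (1 - p)"
    have *: "0 \<le> p * (m - a)" "0 \<le> p * (b - m)" "0 \<le> (1 - p) * (m - a)" "0 \<le> (1 - p) * (b - m)"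
      using assms py by auto
    have "(p, y) \<in> moment_pairs s a b m v"
      using s py * by (auto simp: moment_pairs_def A_def B_def algebra_simps)
    from D[OF this] show "y - (lam - s * m) * p \<le> D" by (simp add: algebra_simps)
  qed (use assms in \<open>auto simp: A_def B_def\<close>)
  then obtain \<Omega> \<omega> t where *: "\<Omega> \<ge> 0" "t + v * \<Omega> \<le> D + \<delta>"
    "\<And>x. x \<in> {-A..B} \<Longrightarrow> max 0 (x - (lam - s * m)) \<le> \<Omega> * x\<^sup>2 + \<omega> * x + t" by blast
  have s2: "s\<^sup>2 = 1" using s by auto
  have "max 0 (s * \<xi> - lam) \<le> \<Omega> * \<xi>\<^sup>2 + (\<omega> * s - 2 * m * \<Omega>) * \<xi> + (t - s * \<omega> * m + \<Omega> * m\<^sup>2)"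
    if "\<xi> \<in> {a..b}" for \<xi>
  proof -
    have "s * (\<xi> - m) \<in> {-A..B}" using that s by (auto simp: A_def B_def)
    moreover have "(s * (\<xi> - m))\<^sup>2 = (\<xi> - m)\<^sup>2" by (simp add: power_mult_distrib s2)
    ultimately have "max 0 (s * (\<xi> - m) - (lam - s * m)) \<le> \<Omega> * (\<xi> - m)\<^sup>2 + \<omega> * (s * (\<xi> - m)) + t"
      using *(3) by metis
    then show ?thesis by (simp add: power2_eq_square algebra_simps)
  qed
  moreover have "(t - s * \<omega> * m + \<Omega> * m\<^sup>2) + m * (\<omega> * s - 2 * m * \<Omega>) + (v + m\<^sup>2) * \<Omega> \<le> D + \<delta>"
    using *(2) by (simp add: power2_eq_square algebra_simps)
  ultimately show ?thesis using *(1) by blast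
qed

section \<open>Decoupling the components by a Lagrange multiplier\<close>

text \<open>A segment from a point left of \<open>e\<close> to one right of \<open>e\<close> crosses
  the vertical at \<open>e\<close> no higher than \<open>V\<close>. Hence slopes from
  \<open>(e, V)\<close> to the right never exceed slopes from the left, and the supremum of the
  former supports \<open>S\<close>. Points on both sides keep the line from being vertical;
  \<open>S\<close> need not be closed.\<close>

lemma supporting_slope:
  fixes S :: "(real \<times> real) set"
  assumes "convex S" and left: "(r1, u1) \<in> S" "r1 < e" and right: "(r2, u2) \<in> S" "e < r2"
    and V: "\<And>u. (e, u) \<in> S \<Longrightarrow> u \<le> V"
  shows "\<exists>k. \<forall>(r, u)\<in>S. u - k * r \<le> V - k * e"
proof -
  have slopes: "(u' - V) / (r' - e) \<le> (V - u) / (e - r)"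
    if "(r, u) \<in> S" "(r', u') \<in> S" "r < e" "e < r'" for r u r' u'
  proof -
    \<comment> \<open>The weights that put the first coordinate of the combination at
      \<open>e\<close>.\<close>
    let ?c = "(r' - e) / (r' - r)" and ?d = "(e - r) / (r' - r)"
    have "?c *\<^sub>R (r, u) + ?d *\<^sub>R (r', u') \<in> S"
      using that by (intro convexD[OF assms(1)]) (auto simp: add_divide_distrib[symmetric])
    moreover have "?c *\<^sub>R (r, u) + ?d *\<^sub>R (r', u') = (e, ((r' - e) * u + (e - r) * u') / (r' - r))"
      using that by (simp add: add_divide_distrib[symmetric] field_simps)
    ultimately have "((r' - e) * u + (e - r) * u') / (r' - r) \<le> V" using V by simp
    then have "(r' - e) * u + (e - r) * u' \<le> V * (r' - r)" using that by (simp add: field_simps)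
    then have "(u' - V) * (e - r) \<le> (V - u) * (r' - e)" by (simp add: algebra_simps)
    then show ?thesis using that by (simp add: field_simps)
  qed
  define L where "L = {(u' - V) / (r' - e) |r' u'. (r', u') \<in> S \<and> e < r'}"
  have "L \<noteq> {}" using right by (auto simp: L_def)
  have "bdd_above L"
    using slopes[OF left(1) _ left(2)] by (auto simp: L_def bdd_above_def)
  define k where "k = Sup L"
  have "u - k * r \<le> V - k * e" if "(r, u) \<in> S" for r u
  proof (cases r e rule: linorder_cases)
    case less
    have "k \<le> (V - u) / (e - r)" unfolding k_def
      using slopes[OF that _ less] \<open>L \<noteq> {}\<close> by (intro cSup_least) (auto simp: L_def)
    then show ?thesis using less by (simp add: field_simps)
  next
    case equal
    then show ?thesis using V that by simp
  next
    case greater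
    then have "(u - V) / (r - e) \<le> k" unfolding k_def
      using that \<open>bdd_above L\<close> by (intro cSup_upper) (auto simp: L_def)
    then show ?thesis using greater by (simp add: field_simps)
  qed
  then show ?thesis by blast
qed

text \<open>The only nonlinear condition reads \<open>y\<^sup>2 + v * p\<^sup>2 \<le> v * p\<close>,
  a convex quadratic below a linear function.\<close>

lemma convex_moment_pairs:
  assumes "v \<ge> 0"
  shows "convex (moment_pairs s a b m v)"
proof (rule convexI)
  fix x1 x2 and c d :: real
  assume x: "x1 \<in> moment_pairs s a b m v" "x2 \<in> moment_pairs s a b m v"
    and cd: "0 \<le> c" "0 \<le> d" "c + d = 1"
  obtain p1 y1 p2 y2 where eq: "x1 = (p1, y1)" "x2 = (p2, y2)" by fastforce
  have lin: "c * f \<le> c * g \<Longrightarrow> d * f' \<le> d * g' \<Longrightarrow> c * f + d * f' \<le> c * g + d * g'" for f g f' g' :: real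
    by linarith
  have square: "(c * y1 + d * y2)\<^sup>2 \<le> c * y1\<^sup>2 + d * y2\<^sup>2" for y1 y2 :: real
  proof -
    have d: "d = 1 - c" using cd by simp
    have "c * y1\<^sup>2 + d * y2\<^sup>2 - (c * y1 + d * y2)\<^sup>2 = c * d * (y1 - y2)\<^sup>2"
      unfolding d by (simp add: power2_eq_square algebra_simps)
    then show ?thesis using cd by (smt (verit) mult_nonneg_nonneg zero_le_power2)
  qed
  have quad: "(c * y1 + d * y2)\<^sup>2 \<le> v * (c * p1 + d * p2) * (1 - (c * p1 + d * p2))"
  proof -
    have "y1\<^sup>2 + v * p1\<^sup>2 \<le> v * p1" "y2\<^sup>2 + v * p2\<^sup>2 \<le> v * p2"
      using x by (auto simp: eq moment_pairs_def power2_eq_square algebra_simps)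
    then have "c * (y1\<^sup>2 + v * p1\<^sup>2) \<le> c * (v * p1)" "d * (y2\<^sup>2 + v * p2\<^sup>2) \<le> d * (v * p2)"
      using cd by (simp_all add: mult_left_mono)
    moreover have "v * (c * p1 + d * p2)\<^sup>2 \<le> v * (c * p1\<^sup>2 + d * p2\<^sup>2)"
      using assms square by (intro mult_left_mono)
    ultimately show ?thesis
      using square[of y1 y2] by (simp add: power2_eq_square algebra_simps)
  qed
  have d: "d = 1 - c" using cd by simp
  have e: "1 - (c * p1 + d * p2) = c * (1 - p1) + d * (1 - p2)" using cd by (simp add: algebra_simps)
  have "c * p1 + d * p2 \<le> c * 1 + d * 1"
    using x cd by (intro add_mono mult_left_mono) (auto simp: eq moment_pairs_def)
  moreover have "c * (p1 * a) + d * (p2 * a) \<le> c * (p1 * m + s * y1) + d * (p2 * m + s * y2)"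
    "c * (p1 * m + s * y1) + d * (p2 * m + s * y2) \<le> c * (p1 * b) + d * (p2 * b)"
    "c * ((1 - p1) * a) + d * ((1 - p2) * a) \<le> c * ((1 - p1) * m - s * y1) + d * ((1 - p2) * m - s * y2)"
    "c * ((1 - p1) * m - s * y1) + d * ((1 - p2) * m - s * y2) \<le> c * ((1 - p1) * b) + d * ((1 - p2) * b)"
    using x cd by (auto simp: eq moment_pairs_def intro!: add_mono mult_left_mono)
  moreover have "0 \<le> c * p1 + d * p2" "0 \<le> c * y1 + d * y2"
    using x cd by (auto simp: eq moment_pairs_def)
  ultimately have "(c * p1 + d * p2, c * y1 + d * y2) \<in> moment_pairs s a b m v"
    unfolding moment_pairs_def mem_Collect_eq case_prod_conv atLeastAtMost_iff using quad
    unfolding e d by (simp add: algebra_simps)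
  then show "c *\<^sub>R x1 + d *\<^sub>R x2 \<in> moment_pairs s a b m v" by (simp add: eq)
qed

text \<open>In the plane of total tail mass and total tail value, the choices of one pair per
  component form a convex set. The slope of its support line at mass \<open>\<epsilon>\<close> is
  the common threshold \<open>lam\<close>. With \<open>lam\<close> fixed, the pairs vary
  independently, so the bound on the sum passes to the sum of the separate suprema
  \<open>D\<close>.\<close>

lemma mixture_majorants:
  fixes \<gamma> \<mu> \<sigma> :: "nat \<Rightarrow> real"
  assumes s: "s = 1 \<or> s = -1"
    and J: "finite J" "\<And>j. j \<in> J \<Longrightarrow> \<gamma> j > 0" "(\<Sum>j\<in>J. \<gamma> j) = 1"
    and \<mu>: "\<And>j. j \<in> J \<Longrightarrow> \<mu> j \<in> {a..b}" and \<sigma>: "\<And>j. j \<in> J \<Longrightarrow> \<sigma> j \<ge> 0"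
    and \<epsilon>: "0 < \<epsilon>" "\<epsilon> < 1" and "\<delta> > 0"
    and V: "\<And>p y. \<lbrakk>\<And>j. j \<in> J \<Longrightarrow> (p j, y j) \<in> moment_pairs s a b (\<mu> j) (\<sigma> j); (\<Sum>j\<in>J. \<gamma> j * p j) = \<epsilon>\<rbrakk>
      \<Longrightarrow> (\<Sum>j\<in>J. \<gamma> j * (s * \<mu> j * p j + y j)) \<le> V"
  shows "\<exists>lam \<Omega> \<omega> t. (\<forall>j\<in>J. \<Omega> j \<ge> 0 \<and>
      (\<forall>\<xi>\<in>{a..b}. max 0 (s * \<xi> - lam) \<le> \<Omega> j * \<xi>\<^sup>2 + \<omega> j * \<xi> + t j)) \<and>
    (\<Sum>j\<in>J. \<gamma> j * (t j + \<mu> j * \<omega> j + (\<sigma> j + (\<mu> j)\<^sup>2) * \<Omega> j)) \<le> V - lam * \<epsilon> + \<delta>"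
proof -
  define G where "G j = moment_pairs s a b (\<mu> j) (\<sigma> j)" for j
  define S where "S = {((\<Sum>j\<in>J. \<gamma> j * p j), (\<Sum>j\<in>J. \<gamma> j * (s * \<mu> j * p j + y j))) |p y.
    \<forall>j\<in>J. (p j, y j) \<in> G j}"
  have "convex S"
  proof (rule convexI)
    fix x1 x2 and c d :: real
    assume x: "x1 \<in> S" "x2 \<in> S" and cd: "0 \<le> c" "0 \<le> d" "c + d = 1"
    obtain p1 y1 where 1: "\<forall>j\<in>J. (p1 j, y1 j) \<in> G j"
      "x1 = ((\<Sum>j\<in>J. \<gamma> j * p1 j), (\<Sum>j\<in>J. \<gamma> j * (s * \<mu> j * p1 j + y1 j)))"
      using x by (auto simp: S_def)
    obtain p2 y2 where 2: "\<forall>j\<in>J. (p2 j, y2 j) \<in> G j"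
      "x2 = ((\<Sum>j\<in>J. \<gamma> j * p2 j), (\<Sum>j\<in>J. \<gamma> j * (s * \<mu> j * p2 j + y2 j)))"
      using x by (auto simp: S_def)
    have "\<forall>j\<in>J. (c * p1 j + d * p2 j, c * y1 j + d * y2 j) \<in> G j"
    proof
      fix j assume "j \<in> J"
      then have "c *\<^sub>R (p1 j, y1 j) + d *\<^sub>R (p2 j, y2 j) \<in> G j"
        using 1(1) 2(1) cd \<sigma> unfolding G_def by (intro convexD[OF convex_moment_pairs]) auto
      then show "(c * p1 j + d * p2 j, c * y1 j + d * y2 j) \<in> G j" by simp
    qed
    moreover have "c *\<^sub>R x1 + d *\<^sub>R x2 = ((\<Sum>j\<in>J. \<gamma> j * (c * p1 j + d * p2 j)),
        (\<Sum>j\<in>J. \<gamma> j * (s * \<mu> j * (c * p1 j + d * p2 j) + (c * y1 j + d * y2 j))))"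
      unfolding 1 2 by (simp add: sum_distrib_left sum.distrib distrib_left mult.assoc mult.left_commute)
    ultimately show "c *\<^sub>R x1 + d *\<^sub>R x2 \<in> S"
      unfolding S_def
      by (intro CollectI exI[of _ "\<lambda>j. c * p1 j + d * p2 j"] exI[of _ "\<lambda>j. c * y1 j + d * y2 j"]) simp
  qed
  \<comment> \<open>These pairs give total masses 0 and 1, on either side of
    \<open>\<epsilon>\<close>, which makes the support line non-vertical.\<close>
  have zero: "(0, 0) \<in> G j" and one: "(1, 0) \<in> G j" if "j \<in> J" for j
    using \<mu>[OF that] by (auto simp: G_def moment_pairs_def)
  have "(0, 0) \<in> S"
    unfolding S_def using zero by (intro CollectI exI[of _ "\<lambda>_. 0"]) auto
  moreover have "(1, \<Sum>j\<in>J. \<gamma> j * (s * \<mu> j)) \<in> S"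
    unfolding S_def using one J(3)
    by (intro CollectI exI[of _ "\<lambda>_. 1"] exI[of _ "\<lambda>_. 0"]) auto
  moreover have "u \<le> V" if "(\<epsilon>, u) \<in> S" for u
    using that V by (auto simp: S_def G_def)
  ultimately have "\<exists>k. \<forall>(r, u)\<in>S. u - k * r \<le> V - k * \<epsilon>"
    using \<epsilon> by (intro supporting_slope[OF \<open>convex S\<close>])
  then obtain lam where lam: "\<And>r u. (r, u) \<in> S \<Longrightarrow> u - lam * r \<le> V - lam * \<epsilon>" by blast
  have bound: "(\<Sum>j\<in>J. \<gamma> j * (s * \<mu> j * p j + y j - lam * p j)) \<le> V - lam * \<epsilon>"
    if "\<forall>j\<in>J. (p j, y j) \<in> G j" for p y
  proof -
    have "((\<Sum>j\<in>J. \<gamma> j * p j), (\<Sum>j\<in>J. \<gamma> j * (s * \<mu> j * p j + y j))) \<in> S"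
      using that by (auto simp: S_def)
    from lam[OF this] show ?thesis
      by (simp add: right_diff_distrib sum_subtractf sum_distrib_left mult.left_commute)
  qed
  define h where "h j = (\<lambda>(p, y). s * \<mu> j * p + y - lam * p)" for j
  define D where "D j = Sup (h j ` G j)" for j
  have bdd: "bdd_above (h j ` G j)" if "j \<in> J" for j
  proof (rule bdd_aboveI2)
    fix q assume "q \<in> G j"
    then obtain p y where q: "q = (p, y)" "0 \<le> p" "p \<le> 1" "0 \<le> y" "y\<^sup>2 \<le> \<sigma> j * p * (1 - p)"
      by (auto simp: G_def moment_pairs_def)
    have "p * (1 - p) \<le> 1" using q by (simp add: mult_le_one)
    then have "\<sigma> j * (p * (1 - p)) \<le> \<sigma> j * 1" using \<sigma>[OF that] by (intro mult_left_mono)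
    then have "y\<^sup>2 \<le> \<sigma> j" using q by (simp add: mult.assoc)
    moreover have "0 \<le> (y - 1)\<^sup>2" by simp
    ultimately have "2 * y \<le> \<sigma> j + 1" by (simp add: power2_eq_square algebra_simps)
    then have "y \<le> \<sigma> j + 1" using \<sigma>[OF that] q by simp
    moreover have "p * (s * \<mu> j - lam) \<le> p * \<bar>s * \<mu> j - lam\<bar>" "p * \<bar>s * \<mu> j - lam\<bar> \<le> 1 * \<bar>s * \<mu> j - lam\<bar>"
      using q by (intro mult_left_mono mult_right_mono; simp)+
    ultimately show "h j q \<le> \<sigma> j + 1 + \<bar>s * \<mu> j - lam\<bar>"
      by (simp add: h_def q algebra_simps)
  qed
  \<comment> \<open>Near-maximisers replace maximisers at the price of half of
    \<open>\<delta>\<close>; the other half is the slack of the quadratic majorants.\<close>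
  have "\<forall>j. \<exists>q. j \<in> J \<longrightarrow> q \<in> G j \<and> D j - \<delta> / 2 < h j q"
  proof (intro allI)
    fix j
    show "\<exists>q. j \<in> J \<longrightarrow> q \<in> G j \<and> D j - \<delta> / 2 < h j q"
    proof (cases "j \<in> J")
      case True
      then have "h j ` G j \<noteq> {}" using zero by blast
      moreover have "D j - \<delta> / 2 < Sup (h j ` G j)" using \<open>\<delta> > 0\<close> by (simp add: D_def)
      ultimately show ?thesis using less_cSup_iff[OF _ bdd[OF True]] by blast
    qed blast
  qed
  then obtain q where q: "\<And>j. j \<in> J \<Longrightarrow> q j \<in> G j \<and> D j - \<delta> / 2 < h j (q j)" by metis
  have "(\<Sum>j\<in>J. \<gamma> j * (D j - \<delta> / 2)) \<le> (\<Sum>j\<in>J. \<gamma> j * h j (q j))"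
    using q J(2) by (intro sum_mono mult_left_mono) (auto simp: less_imp_le)
  also have "\<dots> \<le> V - lam * \<epsilon>"
    using bound[of "\<lambda>j. fst (q j)" "\<lambda>j. snd (q j)"] q by (simp add: h_def case_prod_beta)
  finally have sumD: "(\<Sum>j\<in>J. \<gamma> j * (D j + \<delta> / 2)) \<le> V - lam * \<epsilon> + \<delta>"
    using J(3)
    by (simp add: right_diff_distrib distrib_left sum_subtractf sum.distrib flip: sum_distrib_right sum_divide_distrib)
  have "\<forall>j. \<exists>\<Omega> \<omega> t. j \<in> J \<longrightarrow> \<Omega> \<ge> 0 \<and>
      (\<forall>\<xi>\<in>{a..b}. max 0 (s * \<xi> - lam) \<le> \<Omega> * \<xi>\<^sup>2 + \<omega> * \<xi> + t) \<and>
      t + \<mu> j * \<omega> + (\<sigma> j + (\<mu> j)\<^sup>2) * \<Omega> \<le> D j + \<delta> / 2"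
  proof (intro allI)
    fix j
    show "\<exists>\<Omega> \<omega> t. j \<in> J \<longrightarrow> \<Omega> \<ge> 0 \<and>
      (\<forall>\<xi>\<in>{a..b}. max 0 (s * \<xi> - lam) \<le> \<Omega> * \<xi>\<^sup>2 + \<omega> * \<xi> + t) \<and>
      t + \<mu> j * \<omega> + (\<sigma> j + (\<mu> j)\<^sup>2) * \<Omega> \<le> D j + \<delta> / 2"
    proof (cases "j \<in> J")
      case True
      have "s * \<mu> j * p + y - lam * p \<le> D j" if "(p, y) \<in> moment_pairs s a b (\<mu> j) (\<sigma> j)" for p y
        using cSUP_upper[OF _ bdd[OF True], of "(p, y)"] that by (auto simp: h_def G_def D_def)
      then show ?thesis
        using quadratic_majorant[OF s \<mu>[OF True] \<sigma>[OF True], of "\<delta> / 2" lam "D j"] \<open>\<delta> > 0\<close> by simp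
    qed blast
  qed
  then obtain \<Omega> \<omega> t where f: "\<And>j. j \<in> J \<Longrightarrow> \<Omega> j \<ge> 0 \<and>
      (\<forall>\<xi>\<in>{a..b}. max 0 (s * \<xi> - lam) \<le> \<Omega> j * \<xi>\<^sup>2 + \<omega> j * \<xi> + t j) \<and>
      t j + \<mu> j * \<omega> j + (\<sigma> j + (\<mu> j)\<^sup>2) * \<Omega> j \<le> D j + \<delta> / 2"
    unfolding choice_iff by blast
  have "(\<Sum>j\<in>J. \<gamma> j * (t j + \<mu> j * \<omega> j + (\<sigma> j + (\<mu> j)\<^sup>2) * \<Omega> j)) \<le> (\<Sum>j\<in>J. \<gamma> j * (D j + \<delta> / 2))"
    using f J(2) by (intro sum_mono mult_left_mono) (auto simp: less_imp_le)
  with sumD have "(\<Sum>j\<in>J. \<gamma> j * (t j + \<mu> j * \<omega> j + (\<sigma> j + (\<mu> j)\<^sup>2) * \<Omega> j)) \<le> V - lam * \<epsilon> + \<delta>"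
    by linarith
  with f show ?thesis by blast
qed

section \<open>Expected excess under mixtures and two-point laws\<close>

lemma nn_integral_mixture_measure:
  fixes f :: "real \<Rightarrow> ennreal"
  assumes sets: "\<And>j. j \<in> {1..M} \<Longrightarrow> sets (\<rho> j) = sets borel" and f: "f \<in> borel_measurable borel"
  shows "(\<integral>\<^sup>+x. f x \<partial>mixture_measure M \<gamma> \<rho>) = (\<Sum>j=1..M. ennreal (\<gamma> j) * (\<integral>\<^sup>+x. f x \<partial>\<rho> j))"
proof -
  have meas: "g \<in> borel_measurable (\<rho> j)"
    if "g \<in> borel_measurable borel" "j \<in> {1..M}" for g :: "real \<Rightarrow> ennreal" and j
    using measurable_cong_sets[OF sets[OF that(2)] refl] that(1) by blast
  have meas': "g \<in> borel_measurable (mixture_measure M \<gamma> \<rho>)"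
    if "g \<in> borel_measurable borel" for g :: "real \<Rightarrow> ennreal"
    using measurable_cong_sets[OF sets_mixture_measure refl] that by blast
  show ?thesis
    using f
  proof (induction rule: borel_measurable_induct)
    case (cong f g)
    then show ?case by simp
  next
    case (set S)
    have "(\<integral>\<^sup>+x. indicator S x \<partial>mixture_measure M \<gamma> \<rho>) = emeasure (mixture_measure M \<gamma> \<rho>) S"
      using set by (intro nn_integral_indicator) simp
    also have "\<dots> = (\<Sum>j=1..M. ennreal (\<gamma> j) * emeasure (\<rho> j) S)"
      using set by (intro emeasure_mixture_measure sets)
    also have "\<dots> = (\<Sum>j=1..M. ennreal (\<gamma> j) * (\<integral>\<^sup>+x. indicator S x \<partial>\<rho> j))"
      by (intro sum.cong refl arg_cong2[where f = times] nn_integral_indicator[symmetric])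
        (use set sets in blast)
    finally show ?case .
  next
    case (mult u c)
    have "(\<Sum>j=1..M. ennreal (\<gamma> j) * (\<integral>\<^sup>+x. c * u x \<partial>\<rho> j))
        = (\<Sum>j=1..M. c * (ennreal (\<gamma> j) * (\<integral>\<^sup>+x. u x \<partial>\<rho> j)))"
      using mult by (intro sum.cong refl) (simp add: nn_integral_cmult meas mult.left_commute)
    then show ?case using mult by (simp add: nn_integral_cmult meas' sum_distrib_left)
  next
    case (add u v)
    have "(\<Sum>j=1..M. ennreal (\<gamma> j) * (\<integral>\<^sup>+x. v x + u x \<partial>\<rho> j))
        = (\<Sum>j=1..M. ennreal (\<gamma> j) * (\<integral>\<^sup>+x. v x \<partial>\<rho> j) + ennreal (\<gamma> j) * (\<integral>\<^sup>+x. u x \<partial>\<rho> j))"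
      using add by (intro sum.cong refl) (simp add: nn_integral_add meas distrib_left)
    then show ?case using add by (simp add: nn_integral_add meas' sum.distrib)
  next
    case (seq U)
    have mono: "incseq (\<lambda>i. ennreal (\<gamma> j) * (\<integral>\<^sup>+x. U i x \<partial>\<rho> j))" for j
      using seq(3) by (auto simp: incseq_def le_fun_def intro!: mult_left_mono nn_integral_mono)
    have "(\<integral>\<^sup>+x. (SUP i. U i x) \<partial>mixture_measure M \<gamma> \<rho>)
        = (SUP i. \<integral>\<^sup>+x. U i x \<partial>mixture_measure M \<gamma> \<rho>)"
      by (intro nn_integral_monotone_convergence_SUP meas' seq)
    also have "\<dots> = (SUP i. \<Sum>j=1..M. ennreal (\<gamma> j) * (\<integral>\<^sup>+x. U i x \<partial>\<rho> j))"
      by (intro SUP_cong refl seq)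
    also have "\<dots> = (\<Sum>j=1..M. SUP i. ennreal (\<gamma> j) * (\<integral>\<^sup>+x. U i x \<partial>\<rho> j))"
      using mono by (intro ennreal_SUP_sum)
    also have "\<dots> = (\<Sum>j=1..M. ennreal (\<gamma> j) * (\<integral>\<^sup>+x. (SUP i. U i x) \<partial>\<rho> j))"
    proof (intro sum.cong refl)
      fix j assume "j \<in> {1..M}"
      then have "(\<integral>\<^sup>+x. (SUP i. U i x) \<partial>\<rho> j) = (SUP i. \<integral>\<^sup>+x. U i x \<partial>\<rho> j)"
        by (intro nn_integral_monotone_convergence_SUP meas seq)
      then show "(SUP i. ennreal (\<gamma> j) * (\<integral>\<^sup>+x. U i x \<partial>\<rho> j))
          = ennreal (\<gamma> j) * (\<integral>\<^sup>+x. (SUP i. U i x) \<partial>\<rho> j)"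
        by (simp only: SUP_mult_left_ennreal)
    qed
    finally show ?case by (simp only: SUP_apply)
  qed
qed

text \<open>Shift and bound only translate the threshold, so all later work is done on the component
  laws of the disturbance.\<close>

lemma cvar_shifted_mixture:
  assumes sets: "\<And>j. j \<in> {1..M} \<Longrightarrow> sets (\<rho> j) = sets borel"
  shows "cvar \<epsilon> (distr (mixture_measure M \<gamma> \<rho>) borel (\<lambda>\<xi>. c + \<xi>)) (\<lambda>y. s * (y - u)) =
    (INF \<beta>. ereal \<beta> + ereal (1 / \<epsilon>) * enn2ereal (\<Sum>j=1..M. ennreal (\<gamma> j) *
      (\<integral>\<^sup>+\<xi>. ennreal (max (s * \<xi> - (s * (u - c) + \<beta>)) 0) \<partial>\<rho> j)))"
proof -
  have "(\<integral>\<^sup>+y. ennreal (max (s * (y - u) - \<beta>) 0) \<partial>distr (mixture_measure M \<gamma> \<rho>) borel (\<lambda>\<xi>. c + \<xi>))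
      = (\<Sum>j=1..M. ennreal (\<gamma> j) *
          (\<integral>\<^sup>+\<xi>. ennreal (max (s * \<xi> - (s * (u - c) + \<beta>)) 0) \<partial>\<rho> j))" for \<beta>
    by (subst nn_integral_distr, measurable, subst nn_integral_mixture_measure[OF sets])
      (simp_all add: algebra_simps)
  then show ?thesis by (simp add: cvar_def)
qed

text \<open>Weak duality for one component: integrate the majorant. The second moment is only
  bounded from above, which is where the sign of \<open>\<Omega>\<close> enters. The second claim
  lets weighted sums of the bounds pass through \<open>ennreal\<close>, which truncates negative
  numbers.\<close>

lemma moment_ambiguity_quadratic_bound:
  assumes \<rho>: "\<rho> \<in> moment_ambiguity a b m v" and "\<Omega> \<ge> 0"
    and g: "\<And>\<xi>. \<xi> \<in> {a..b} \<Longrightarrow> max 0 (g \<xi>) \<le> \<Omega> * \<xi>\<^sup>2 + \<omega> * \<xi> + t"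
  shows "(\<integral>\<^sup>+\<xi>. ennreal (max (g \<xi>) 0) \<partial>\<rho>) \<le> ennreal (t + m * \<omega> + (v + m\<^sup>2) * \<Omega>)"
    and "0 \<le> t + m * \<omega> + (v + m\<^sup>2) * \<Omega>"
proof -
  have sets [measurable_cong]: "sets \<rho> = sets borel" and mean: "(\<integral>\<xi>. \<xi> \<partial>\<rho>) = m"
    and var: "(\<integral>\<xi>. (\<xi> - m)\<^sup>2 \<partial>\<rho>) \<le> v" and null: "emeasure \<rho> (- {a..b}) = 0"
    and prob: "prob_space \<rho>"
    using \<rho> by (auto simp: moment_ambiguity_def)
  interpret prob_space \<rho> by (fact prob)
  have supp: "AE \<xi> in \<rho>. \<xi> \<in> {a..b}"
    using null by (intro AE_I[where N = "- {a..b}"]) (auto simp: sets)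
  have int1: "integrable \<rho> (\<lambda>\<xi>. \<xi>)"
    by (rule integrable_const_bound[where B = "\<bar>a\<bar> + \<bar>b\<bar>"]) (use supp in \<open>auto elim!: eventually_elim2\<close>)
  have int2: "integrable \<rho> (\<lambda>\<xi>. \<xi>\<^sup>2)"
  proof (rule integrable_const_bound[where B = "(\<bar>a\<bar> + \<bar>b\<bar>)\<^sup>2"])
    show "AE \<xi> in \<rho>. norm (\<xi>\<^sup>2) \<le> (\<bar>a\<bar> + \<bar>b\<bar>)\<^sup>2"
      using supp
    proof eventually_elim
      case (elim \<xi>)
      then have "\<bar>\<xi>\<bar>\<^sup>2 \<le> (\<bar>a\<bar> + \<bar>b\<bar>)\<^sup>2" by (intro power_mono) auto
      then show ?case by simp
    qed
  qed measurable
  have "(\<integral>\<xi>. (\<xi> - m)\<^sup>2 \<partial>\<rho>) = (\<integral>\<xi>. \<xi>\<^sup>2 - 2 * m * \<xi> + m\<^sup>2 \<partial>\<rho>)"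
    by (simp add: power2_eq_square algebra_simps)
  also have "\<dots> = (\<integral>\<xi>. \<xi>\<^sup>2 \<partial>\<rho>) - m\<^sup>2"
    using int1 int2 by (simp add: mean prob_space power2_eq_square)
  finally have second: "(\<integral>\<xi>. \<xi>\<^sup>2 \<partial>\<rho>) \<le> v + m\<^sup>2" using var by simp
  let ?f = "\<lambda>\<xi>. \<Omega> * \<xi>\<^sup>2 + \<omega> * \<xi> + t"
  have "integrable \<rho> ?f" using int1 int2 by simp
  have nonneg: "AE \<xi> in \<rho>. 0 \<le> ?f \<xi>"
    using supp by eventually_elim (use g in force)
  have "(\<integral>\<xi>. ?f \<xi> \<partial>\<rho>) = \<Omega> * (\<integral>\<xi>. \<xi>\<^sup>2 \<partial>\<rho>) + \<omega> * m + t"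
    using int1 int2 by (simp add: mean prob_space)
  also have "\<dots> \<le> \<Omega> * (v + m\<^sup>2) + \<omega> * m + t"
    using mult_left_mono[OF second \<open>\<Omega> \<ge> 0\<close>] by simp
  finally have le: "(\<integral>\<xi>. ?f \<xi> \<partial>\<rho>) \<le> t + m * \<omega> + (v + m\<^sup>2) * \<Omega>" by (simp add: mult_ac)
  moreover have "0 \<le> (\<integral>\<xi>. ?f \<xi> \<partial>\<rho>)" by (intro integral_nonneg_AE nonneg)
  ultimately show "0 \<le> t + m * \<omega> + (v + m\<^sup>2) * \<Omega>" by linarith
  have "(\<integral>\<^sup>+\<xi>. ennreal (max (g \<xi>) 0) \<partial>\<rho>) \<le> (\<integral>\<^sup>+\<xi>. ennreal (?f \<xi>) \<partial>\<rho>)"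
    by (intro nn_integral_mono_AE, use supp in eventually_elim)
      (use g in \<open>auto intro!: ennreal_leI simp: max.commute\<close>)
  also have "\<dots> = ennreal (\<integral>\<xi>. ?f \<xi> \<partial>\<rho>)"
    by (intro nn_integral_eq_integral nonneg \<open>integrable \<rho> ?f\<close>)
  also have "\<dots> \<le> ennreal (t + m * \<omega> + (v + m\<^sup>2) * \<Omega>)" by (intro ennreal_leI le)
  finally show "(\<integral>\<^sup>+\<xi>. ennreal (max (g \<xi>) 0) \<partial>\<rho>) \<le> \<dots>" .
qed

text \<open>One law must serve every \<open>lam\<close>, since CVaR minimises over the threshold
  after the law is fixed. The bound drops the atom \<open>x2\<close>; the atom \<open>x1\<close> of
  mass \<open>p\<close> contributes exactly the left-hand side.\<close>

lemma two_point_measure: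
  assumes s: "s = 1 \<or> s = -1" and ab: "m \<in> {a..b}" and v: "v \<ge> 0"
    and py: "(p, y) \<in> moment_pairs s a b m v"
  shows "\<exists>\<rho>\<in>moment_ambiguity a b m v. \<forall>lam.
    ennreal (max 0 (s * m * p + y - lam * p)) \<le> (\<integral>\<^sup>+\<xi>. ennreal (max (s * \<xi> - lam) 0) \<partial>\<rho>)"
proof -
  have p: "0 \<le> p" "p \<le> 1" and y: "y\<^sup>2 \<le> v * p * (1 - p)"
    and 1: "p * m + s * y \<in> {p * a..p * b}" and 2: "(1 - p) * m - s * y \<in> {(1 - p) * a..(1 - p) * b}"
    using py by (auto simp: moment_pairs_def)
  have s2: "s * s = 1" using s by auto
  have y0: "y = 0" if "p = 0 \<or> p = 1" using y that by auto
  (* In the degenerate cases division by 0 places the massless atom at m, inside the support. *)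
  define x1 where "x1 = m + s * y / p"
  define x2 where "x2 = m - s * y / (1 - p)"
  have x1: "p * x1 = p * m + s * y" using y0 by (cases "p = 0") (auto simp: x1_def field_simps)
  have x2: "(1 - p) * x2 = (1 - p) * m - s * y"
    using y0 by (cases "p = 1") (auto simp: x2_def field_simps)
  have "x1 \<in> {a..b}" using 1 p ab y0 unfolding x1[symmetric] by (cases "p = 0") (auto simp: x1_def)
  moreover have "x2 \<in> {a..b}" using 2 p ab y0 unfolding x2[symmetric]
    by (cases "p = 1") (auto simp: x2_def)
  moreover have var: "p * (x1 - m)\<^sup>2 + (1 - p) * (x2 - m)\<^sup>2 \<le> v"
  proof (cases "p = 0 \<or> p = 1")
    case True
    then show ?thesis using y0 v by (auto simp: x1_def x2_def)
  next
    case False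
    with p have pos: "0 < p" "0 < 1 - p" by auto
    have "p * (x1 - m)\<^sup>2 + (1 - p) * (x2 - m)\<^sup>2 = (s * y)\<^sup>2 / p + (s * y)\<^sup>2 / (1 - p)"
      using pos by (simp add: x1_def x2_def power2_eq_square)
    also have "\<dots> = y\<^sup>2 / p + y\<^sup>2 / (1 - p)"
      using s2 by (simp add: power_mult_distrib power2_eq_square[of s])
    also have "\<dots> = y\<^sup>2 / (p * (1 - p))"
      using pos by (simp add: add_frac_eq) (simp add: algebra_simps)
    also have "\<dots> \<le> v" using y pos by (simp add: pos_divide_le_eq mult.assoc)
    finally show ?thesis .
  qed
  define \<rho> where "\<rho> = distr (measure_pmf (bernoulli_pmf p)) borel (\<lambda>c. if c then x1 else x2)"
  have [simp]: "sets \<rho> = sets borel" by (simp add: \<rho>_def)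
  have "prob_space \<rho>"
    unfolding \<rho>_def by (intro measure_pmf.prob_space_distr) simp
  moreover have "emeasure \<rho> (- {a..b}) = 0"
    using \<open>x1 \<in> {a..b}\<close> \<open>x2 \<in> {a..b}\<close>
    by (simp add: \<rho>_def emeasure_distr vimage_def)
  moreover have int: "(\<integral>\<xi>. f \<xi> \<partial>\<rho>) = p * f x1 + (1 - p) * f x2"
    if [measurable]: "f \<in> borel_measurable borel" for f :: "real \<Rightarrow> real"
    using p by (simp add: \<rho>_def integral_distr)
  moreover have "(\<integral>\<xi>. \<xi> \<partial>\<rho>) = m"
    using int[of "\<lambda>\<xi>. \<xi>"] x1 x2 by (simp add: left_diff_distrib)
  moreover have "(\<integral>\<xi>. (\<xi> - m)\<^sup>2 \<partial>\<rho>) \<le> v"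
    using int[of "\<lambda>\<xi>. (\<xi> - m)\<^sup>2"] var by simp
  ultimately have "\<rho> \<in> moment_ambiguity a b m v"
    by (simp add: moment_ambiguity_def)
  moreover have "ennreal (max 0 (s * m * p + y - lam * p))
    \<le> (\<integral>\<^sup>+\<xi>. ennreal (max (s * \<xi> - lam) 0) \<partial>\<rho>)" for lam
  proof -
    have "p * (s * x1 - lam) = s * (p * x1) - lam * p" by (simp add: algebra_simps)
    also have "\<dots> = s * m * p + y - lam * p" unfolding x1 using s2 by (simp add: algebra_simps)
    finally have "max 0 (s * m * p + y - lam * p) = max (s * x1 - lam) 0 * p"
      using p by (smt (verit, best) mult.commute mult_eq_0_iff mult_nonneg_nonneg mult_nonneg_nonpos)
    then have "ennreal (max 0 (s * m * p + y - lam * p)) = ennreal (max (s * x1 - lam) 0) * ennreal p"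
      by (metis ennreal_mult max.cobounded2 p(1))
    also have "\<dots> \<le> ennreal (max (s * x1 - lam) 0) * ennreal p
        + ennreal (max (s * x2 - lam) 0) * ennreal (1 - p)" by simp
    also have "\<dots> = (\<integral>\<^sup>+\<xi>. ennreal (max (s * \<xi> - lam) 0) \<partial>\<rho>)"
      using p unfolding \<rho>_def by (subst nn_integral_distr) auto
    finally show ?thesis .
  qed
  ultimately show ?thesis by blast
qed

section \<open>Duality between the worst-case CVaR and the cone program\<close>

text \<open>If some mean lies outside the support, the ambiguity set is empty and the supremum is \<open>-\<infinity>\<close>.
  A multiple of an affine function that is nonnegative on the support but negative at that mean
  makes every \<open>\<eta>\<close> feasible.\<close>

lemma infeasible_mean_majorants:
  fixes \<gamma> \<mu> :: "nat \<Rightarrow> real"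
  assumes s: "s = 1 \<or> s = -1"
    and J: "finite J" "\<And>j. j \<in> J \<Longrightarrow> \<gamma> j > 0" "(\<Sum>j\<in>J. \<gamma> j) = 1"
    and k: "k \<in> J" "\<mu> k \<notin> {a..b}"
  shows "\<exists>\<omega> t. (\<forall>j\<in>J. \<forall>\<xi>\<in>{a..b}. max 0 (s * \<xi> - lam) \<le> \<omega> j * \<xi> + t j) \<and>
    (\<Sum>j\<in>J. \<gamma> j * (t j + \<mu> j * \<omega> j)) \<le> 0"
proof -
  define C where "C = \<bar>a\<bar> + \<bar>b\<bar> + \<bar>lam\<bar>"
  have C: "max 0 (s * \<xi> - lam) \<le> C" if "\<xi> \<in> {a..b}" for \<xi>
    using that s by (auto simp: C_def)
  have "\<exists>w u. w * \<mu> k + u < 0 \<and> (\<forall>\<xi>\<in>{a..b}. 0 \<le> w * \<xi> + u)"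
  proof (cases "\<mu> k < a")
    case True
    then show ?thesis by (intro exI[of _ 1] exI[of _ "-a"]) auto
  next
    case False
    then show ?thesis using k by (intro exI[of _ "-1"] exI[of _ b]) auto
  qed
  then obtain w u where wu: "w * \<mu> k + u < 0" "\<And>\<xi>. \<xi> \<in> {a..b} \<Longrightarrow> 0 \<le> w * \<xi> + u" by blast
  define d where "d = - (w * \<mu> k + u)"
  \<comment> \<open>Scaled so that the \<open>k\<close>-th affine term contributes \<open>-C\<close>
    to the weighted sum. This cancels the constant \<open>C\<close> that dominates the hinge in
    every component.\<close>
  define r where "r = C / (\<gamma> k * d)"
  have d: "d > 0" "w * \<mu> k + u = - d" using wu(1) by (auto simp: d_def)
  have "r \<ge> 0" unfolding r_def C_def
    using d J(2)[OF k(1)] by (intro divide_nonneg_pos mult_pos_pos) auto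
  have r: "\<gamma> k * (r * (w * \<mu> k + u)) = - C"
    unfolding d(2) r_def using d(1) J(2)[OF k(1)] by simp
  define \<omega> t where "\<omega> = (\<lambda>j. if j = k then r * w else 0)" and "t = (\<lambda>j. if j = k then C + r * u else C)"
  have "max 0 (s * \<xi> - lam) \<le> \<omega> j * \<xi> + t j" if "\<xi> \<in> {a..b}" for \<xi> j
  proof -
    have "0 \<le> r * (w * \<xi> + u)" using \<open>r \<ge> 0\<close> wu(2)[OF that] by simp
    then show ?thesis using C[OF that] by (auto simp: \<omega>_def t_def algebra_simps)
  qed
  moreover have "(\<Sum>j\<in>J. \<gamma> j * (t j + \<mu> j * \<omega> j)) = 0"
  proof -
    have "\<gamma> j * (t j + \<mu> j * \<omega> j) = \<gamma> j * C + (if j = k then - C else 0)" for j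
      using r by (simp add: \<omega>_def t_def algebra_simps)
    then have "(\<Sum>j\<in>J. \<gamma> j * (t j + \<mu> j * \<omega> j)) = (\<Sum>j\<in>J. \<gamma> j) * C - C"
      using J(1) k(1) by (simp add: sum.distrib sum_distrib_right)
    then show ?thesis using J(3) by simp
  qed
  ultimately show ?thesis by (intro exI[of _ \<omega>] exI[of _ t]) simp
qed

text \<open>Right to left is weak duality at a single threshold; left to right combines the
  multiplier argument with the case of a mean outside the support.\<close>

lemma dr_cvar_iff_socp_value:
  fixes \<gamma> \<mu> \<sigma> :: "nat \<Rightarrow> real"
  assumes "a \<le> b" and \<epsilon>: "0 < \<epsilon>" "\<epsilon> < 1"
    and \<gamma>: "\<And>j. j \<in> {1..M} \<Longrightarrow> \<gamma> j > 0" "(\<Sum>j=1..M. \<gamma> j) = 1"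
    and \<sigma>: "\<And>j. j \<in> {1..M} \<Longrightarrow> \<sigma> j \<ge> 0"
  shows "(SUP q\<in>shifted_ambiguity c (disturbance_ambiguity a b M \<gamma> \<mu> \<sigma>).
      cvar \<epsilon> q (\<lambda>y. (-1)^i * (y - u))) \<le> 0 \<longleftrightarrow>
    socp_value i \<epsilon> a b M \<gamma> \<mu> \<sigma> \<le> ereal ((-1)^i * (u - c))"
proof
  define s :: real where "s = (-1)^i"
  have s: "s = 1 \<or> s = -1" unfolding s_def by (cases "even i") auto
  \<comment> \<open>The room that the tightening may use. A CVaR threshold \<open>\<beta>\<close> of
    the loss corresponds to the hinge threshold \<open>\<kappa> + \<beta>\<close>.\<close>
  define \<kappa> where "\<kappa> = s * (u - c)"
  note cvar = cvar_shifted_mixture[of M _ \<epsilon> \<gamma> c s u, folded \<kappa>_def]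
  have sets: "sets \<rho> = sets borel" if "\<rho> \<in> moment_ambiguity a b m v" for \<rho> m v
    using that by (simp add: moment_ambiguity_def)
  {
    assume le: "socp_value i \<epsilon> a b M \<gamma> \<mu> \<sigma> \<le> ereal ((-1)^i * (u - c))"
    show "(SUP q\<in>shifted_ambiguity c (disturbance_ambiguity a b M \<gamma> \<mu> \<sigma>).
      cvar \<epsilon> q (\<lambda>y. (-1)^i * (y - u))) \<le> 0"
      unfolding s_def[symmetric]
    proof (rule SUP_least)
      fix q assume "q \<in> shifted_ambiguity c (disturbance_ambiguity a b M \<gamma> \<mu> \<sigma>)"
      then obtain \<rho> where q: "q = distr (mixture_measure M \<gamma> \<rho>) borel (\<lambda>\<xi>. c + \<xi>)"
        and \<rho>: "\<And>j. j \<in> {1..M} \<Longrightarrow> \<rho> j \<in> moment_ambiguity a b (\<mu> j) (\<sigma> j)"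
        by (auto simp: shifted_ambiguity_def disturbance_ambiguity_def)
      show "cvar \<epsilon> q (\<lambda>y. s * (y - u)) \<le> 0"
      proof (rule ereal_le_epsilon2)
        fix e :: real assume "0 < e"
        then have "socp_value i \<epsilon> a b M \<gamma> \<mu> \<sigma> < ereal (\<kappa> + e)"
          using le by (simp add: \<kappa>_def s_def le_less_trans)
        then obtain \<eta> \<beta> t \<omega> \<Omega> where "\<eta> < \<kappa> + e"
          and "\<exists>\<phi>1 \<phi>2 \<psi>1 \<psi>2. socp_feasible i \<epsilon> a b M \<gamma> \<mu> \<sigma> \<eta> \<beta> t \<omega> \<Omega> \<phi>1 \<phi>2 \<psi>1 \<psi>2"
          unfolding socp_value_def Inf_less_iff by (auto; blast)
        then have budget: "\<epsilon> * \<beta> + (\<Sum>j=1..M. \<gamma> j * (t j + \<mu> j * \<omega> j + (\<sigma> j + (\<mu> j)\<^sup>2) * \<Omega> j)) \<le> 0"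
          and maj: "\<And>j. j \<in> {1..M} \<Longrightarrow> \<Omega> j \<ge> 0 \<and>
            (\<forall>\<xi>\<in>{a..b}. max 0 (s * \<xi> - (\<beta> + \<eta>)) \<le> \<Omega> j * \<xi>\<^sup>2 + \<omega> j * \<xi> + t j)"
          unfolding socp_feasible_iff[OF \<open>a \<le> b\<close>] s_def by auto
        let ?val = "\<lambda>j. t j + \<mu> j * \<omega> j + (\<sigma> j + (\<mu> j)\<^sup>2) * \<Omega> j"
        have val: "0 \<le> ?val j" "(\<integral>\<^sup>+\<xi>. ennreal (max (s * \<xi> - (\<beta> + \<eta>)) 0) \<partial>\<rho> j) \<le> ennreal (?val j)"
          if "j \<in> {1..M}" for j
          using moment_ambiguity_quadratic_bound[OF \<rho>[OF that], of "\<Omega> j" "\<lambda>\<xi>. s * \<xi> - (\<beta> + \<eta>)" "\<omega> j" "t j"]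
            maj[OF that] by blast+
        have "(\<Sum>j=1..M. ennreal (\<gamma> j) * (\<integral>\<^sup>+\<xi>. ennreal (max (s * \<xi> - (\<beta> + \<eta>)) 0) \<partial>\<rho> j))
            \<le> (\<Sum>j=1..M. ennreal (\<gamma> j) * ennreal (?val j))"
          using val by (intro sum_mono mult_left_mono) auto
        also have "\<dots> = (\<Sum>j=1..M. ennreal (\<gamma> j * ?val j))"
          using val \<gamma>(1) by (intro sum.cong refl ennreal_mult[symmetric]) (auto simp: less_imp_le)
        also have "\<dots> = ennreal (\<Sum>j=1..M. \<gamma> j * ?val j)"
          using val \<gamma>(1) by (intro sum_ennreal mult_nonneg_nonneg) (auto simp: less_imp_le)
        also have "\<dots> \<le> ennreal (- (\<epsilon> * \<beta>))" using budget by (intro ennreal_leI) linarith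
        finally have sum: "(\<Sum>j=1..M. ennreal (\<gamma> j) *
          (\<integral>\<^sup>+\<xi>. ennreal (max (s * \<xi> - (\<beta> + \<eta>)) 0) \<partial>\<rho> j)) \<le> ennreal (- (\<epsilon> * \<beta>))" .
        have "0 \<le> (\<Sum>j=1..M. \<gamma> j * ?val j)"
          using val \<gamma>(1) by (intro sum_nonneg mult_nonneg_nonneg) (auto simp: less_imp_le)
        with budget have "0 \<le> - (\<epsilon> * \<beta>)" by linarith
        \<comment> \<open>This CVaR threshold reproduces the hinge threshold
          \<open>\<beta> + \<eta>\<close>. The budget bounds the scaled excess by
          \<open>- \<beta>\<close>, leaving \<open>\<eta> - \<kappa>\<close>.\<close>
        have "cvar \<epsilon> q (\<lambda>y. s * (y - u)) \<le> ereal (\<beta> + \<eta> - \<kappa>) + ereal (1 / \<epsilon>) *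
          enn2ereal (\<Sum>j=1..M. ennreal (\<gamma> j) *
            (\<integral>\<^sup>+\<xi>. ennreal (max (s * \<xi> - (\<kappa> + (\<beta> + \<eta> - \<kappa>))) 0) \<partial>\<rho> j))"
          unfolding q
        proof (subst cvar)
          show "(INF \<beta>. ereal \<beta> + ereal (1 / \<epsilon>) * enn2ereal (\<Sum>j=1..M. ennreal (\<gamma> j) *
              (\<integral>\<^sup>+\<xi>. ennreal (max (s * \<xi> - (\<kappa> + \<beta>)) 0) \<partial>\<rho> j)))
            \<le> ereal (\<beta> + \<eta> - \<kappa>) + ereal (1 / \<epsilon>) * enn2ereal (\<Sum>j=1..M. ennreal (\<gamma> j) *
              (\<integral>\<^sup>+\<xi>. ennreal (max (s * \<xi> - (\<kappa> + (\<beta> + \<eta> - \<kappa>))) 0) \<partial>\<rho> j))"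
            by (rule INF_lower[OF UNIV_I])
        qed (use sets \<rho> in blast)
        also have "\<dots> \<le> ereal (\<beta> + \<eta> - \<kappa>) + ereal (1 / \<epsilon>) * enn2ereal (ennreal (- (\<epsilon> * \<beta>)))"
          using sum \<epsilon> by (intro add_left_mono ereal_mult_left_mono) (auto simp: less_eq_ennreal.rep_eq[symmetric])
        also have "\<dots> = ereal (\<eta> - \<kappa>)"
          using \<open>0 \<le> - (\<epsilon> * \<beta>)\<close> \<epsilon> by (simp add: enn2ereal_ennreal)
        also have "\<dots> \<le> 0 + ereal e" using \<open>\<eta> < \<kappa> + e\<close> by simp
        finally show "cvar \<epsilon> q (\<lambda>y. s * (y - u)) \<le> 0 + ereal e" .
      qed
    qed
  }
  assume "(SUP q\<in>shifted_ambiguity c (disturbance_ambiguity a b M \<gamma> \<mu> \<sigma>).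
      cvar \<epsilon> q (\<lambda>y. (-1)^i * (y - u))) \<le> 0"
  then have sup: "\<forall>q\<in>shifted_ambiguity c (disturbance_ambiguity a b M \<gamma> \<mu> \<sigma>).
      cvar \<epsilon> q (\<lambda>y. s * (y - u)) \<le> 0"
    unfolding SUP_le_iff s_def .
  have le0: "cvar \<epsilon> (distr (mixture_measure M \<gamma> \<rho>) borel (\<lambda>\<xi>. c + \<xi>)) (\<lambda>y. s * (y - u)) \<le> 0"
    if "\<And>j. j \<in> {1..M} \<Longrightarrow> \<rho> j \<in> moment_ambiguity a b (\<mu> j) (\<sigma> j)" for \<rho>
  proof (rule sup[rule_format])
    have "mixture_measure M \<gamma> \<rho> \<in> disturbance_ambiguity a b M \<gamma> \<mu> \<sigma>"
      using that unfolding disturbance_ambiguity_def by blast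
    then show "distr (mixture_measure M \<gamma> \<rho>) borel (\<lambda>\<xi>. c + \<xi>)
        \<in> shifted_ambiguity c (disturbance_ambiguity a b M \<gamma> \<mu> \<sigma>)"
      unfolding shifted_ambiguity_def by blast
  qed
  have value_le: "socp_value i \<epsilon> a b M \<gamma> \<mu> \<sigma> \<le> ereal \<eta>"
    if "\<epsilon> * \<beta> + (\<Sum>j=1..M. \<gamma> j * (t j + \<mu> j * \<omega> j + (\<sigma> j + (\<mu> j)\<^sup>2) * \<Omega> j)) \<le> 0"
      "\<forall>j\<in>{1..M}. \<Omega> j \<ge> 0 \<and>
        (\<forall>\<xi>\<in>{a..b}. max 0 (s * \<xi> - (\<beta> + \<eta>)) \<le> \<Omega> j * \<xi>\<^sup>2 + \<omega> j * \<xi> + t j)" for \<eta> \<beta> t \<omega> \<Omega>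
    unfolding socp_value_def
    by (rule Inf_lower) (use socp_feasible_iff[OF \<open>a \<le> b\<close>, THEN iffD2, OF conjI, OF that[unfolded s_def]] in blast)
  show "socp_value i \<epsilon> a b M \<gamma> \<mu> \<sigma> \<le> ereal ((-1)^i * (u - c))"
    unfolding s_def[symmetric] \<kappa>_def[symmetric]
  proof (rule ereal_le_epsilon2)
    fix e :: real assume "0 < e"
    have "socp_value i \<epsilon> a b M \<gamma> \<mu> \<sigma> \<le> ereal (\<kappa> + e)"
    proof (cases "\<forall>j\<in>{1..M}. \<mu> j \<in> {a..b}")
      case False
      then obtain k where k: "k \<in> {1..M}" "\<mu> k \<notin> {a..b}" by blast
      have "\<exists>\<omega> t. (\<forall>j\<in>{1..M}. \<forall>\<xi>\<in>{a..b}. max 0 (s * \<xi> - (\<kappa> + e)) \<le> \<omega> j * \<xi> + t j) \<and>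
          (\<Sum>j=1..M. \<gamma> j * (t j + \<mu> j * \<omega> j)) \<le> 0"
        by (rule infeasible_mean_majorants[where J = "{1..M}" and k = k])
          (fact s finite_atLeastAtMost \<gamma> k)+
      then obtain \<omega> t
        where "\<forall>j\<in>{1..M}. \<forall>\<xi>\<in>{a..b}. max 0 (s * \<xi> - (\<kappa> + e)) \<le> \<omega> j * \<xi> + t j"
          "(\<Sum>j=1..M. \<gamma> j * (t j + \<mu> j * \<omega> j)) \<le> 0" by blast
      then show ?thesis by (intro value_le[where \<beta> = 0 and \<Omega> = "\<lambda>_. 0"]) auto
    next
      case True
      have "(\<Sum>j=1..M. \<gamma> j * (s * \<mu> j * p j + y j)) \<le> \<epsilon> * \<kappa>"
        if py: "\<And>j. j \<in> {1..M} \<Longrightarrow> (p j, y j) \<in> moment_pairs s a b (\<mu> j) (\<sigma> j)"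
          and p: "(\<Sum>j=1..M. \<gamma> j * p j) = \<epsilon>" for p y
      proof -
        have "\<forall>j. \<exists>\<rho>. j \<in> {1..M} \<longrightarrow> \<rho> \<in> moment_ambiguity a b (\<mu> j) (\<sigma> j) \<and> (\<forall>lam.
          ennreal (max 0 (s * \<mu> j * p j + y j - lam * p j))
            \<le> (\<integral>\<^sup>+\<xi>. ennreal (max (s * \<xi> - lam) 0) \<partial>\<rho>))"
          using two_point_measure[OF s _ \<sigma> py] True by blast
        then obtain \<rho> where \<rho>: "\<And>j. j \<in> {1..M} \<Longrightarrow> \<rho> j \<in> moment_ambiguity a b (\<mu> j) (\<sigma> j)"
          and tail: "\<And>j lam. j \<in> {1..M} \<Longrightarrow> ennreal (max 0 (s * \<mu> j * p j + y j - lam * p j))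
            \<le> (\<integral>\<^sup>+\<xi>. ennreal (max (s * \<xi> - lam) 0) \<partial>\<rho> j)"
          unfolding choice_iff by blast
        let ?Y = "\<Sum>j=1..M. \<gamma> j * (s * \<mu> j * p j + y j)"
        \<comment> \<open>The bound is free of the CVaR threshold: as the weighted masses sum to
          \<open>\<epsilon>\<close>, its contribution is
          \<open>\<beta> - (\<kappa> + \<beta>)\<close>.\<close>
        have "ereal (?Y / \<epsilon> - \<kappa>) \<le> cvar \<epsilon> (distr (mixture_measure M \<gamma> \<rho>) borel (\<lambda>\<xi>. c + \<xi>)) (\<lambda>y. s * (y - u))"
        proof (subst cvar)
          show "ereal (?Y / \<epsilon> - \<kappa>) \<le> (INF \<beta>. ereal \<beta> + ereal (1 / \<epsilon>) * enn2ereal (\<Sum>j=1..M.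
            ennreal (\<gamma> j) * (\<integral>\<^sup>+\<xi>. ennreal (max (s * \<xi> - (\<kappa> + \<beta>)) 0) \<partial>\<rho> j)))"
          proof (rule INF_greatest)
            fix \<beta> :: real
            let ?m = "\<lambda>j. max 0 (s * \<mu> j * p j + y j - (\<kappa> + \<beta>) * p j)"
            have "?Y - (\<kappa> + \<beta>) * \<epsilon> = (\<Sum>j=1..M. \<gamma> j * (s * \<mu> j * p j + y j - (\<kappa> + \<beta>) * p j))"
              unfolding p[symmetric]
              by (simp add: right_diff_distrib sum_subtractf sum_distrib_left mult.left_commute)
            also have "\<dots> \<le> (\<Sum>j=1..M. \<gamma> j * ?m j)"
              using \<gamma>(1) by (intro sum_mono mult_left_mono) (auto simp: less_imp_le)
            finally have Y: "?Y - (\<kappa> + \<beta>) * \<epsilon> \<le> (\<Sum>j=1..M. \<gamma> j * ?m j)" .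
            have nonneg: "0 \<le> (\<Sum>j=1..M. \<gamma> j * ?m j)"
              using \<gamma>(1) by (intro sum_nonneg mult_nonneg_nonneg) (auto simp: less_imp_le)
            have "ennreal (\<Sum>j=1..M. \<gamma> j * ?m j) = (\<Sum>j=1..M. ennreal (\<gamma> j) * ennreal (?m j))"
              using \<gamma>(1) by (subst sum_ennreal[symmetric]) (auto simp: less_imp_le ennreal_mult)
            also have "\<dots> \<le> (\<Sum>j=1..M. ennreal (\<gamma> j) *
                (\<integral>\<^sup>+\<xi>. ennreal (max (s * \<xi> - (\<kappa> + \<beta>)) 0) \<partial>\<rho> j))"
              using tail by (intro sum_mono mult_left_mono) auto
            finally have I: "ereal (\<Sum>j=1..M. \<gamma> j * ?m j) \<le> enn2ereal (\<Sum>j=1..M. ennreal (\<gamma> j) *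
                (\<integral>\<^sup>+\<xi>. ennreal (max (s * \<xi> - (\<kappa> + \<beta>)) 0) \<partial>\<rho> j))"
              using nonneg by (simp add: less_eq_ennreal.rep_eq enn2ereal_ennreal)
            have "?Y / \<epsilon> - \<kappa> = \<beta> + 1 / \<epsilon> * (?Y - (\<kappa> + \<beta>) * \<epsilon>)"
              using \<epsilon> by (simp add: field_simps)
            also have "\<dots> \<le> \<beta> + 1 / \<epsilon> * (\<Sum>j=1..M. \<gamma> j * ?m j)"
              using Y \<epsilon> by (intro add_left_mono mult_left_mono) auto
            finally have "ereal (?Y / \<epsilon> - \<kappa>) \<le> ereal \<beta> + ereal (1 / \<epsilon>) * ereal (\<Sum>j=1..M. \<gamma> j * ?m j)"
              by simp
            also have "\<dots> \<le> ereal \<beta> + ereal (1 / \<epsilon>) * enn2ereal (\<Sum>j=1..M. ennreal (\<gamma> j) *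
                (\<integral>\<^sup>+\<xi>. ennreal (max (s * \<xi> - (\<kappa> + \<beta>)) 0) \<partial>\<rho> j))"
              using I \<epsilon> by (intro add_left_mono ereal_mult_left_mono) auto
            finally show "ereal (?Y / \<epsilon> - \<kappa>) \<le> \<dots>" .
          qed
        qed (use sets \<rho> in blast)
        also have "\<dots> \<le> 0" by (rule le0[OF \<rho>])
        finally show ?thesis using \<epsilon> by (simp add: field_simps)
      qed
      \<comment> \<open>The budget row carries the factor \<open>\<epsilon>\<close>, so relaxing
        \<open>\<eta>\<close> to \<open>\<kappa> + e\<close> pays for a slack of
        \<open>\<epsilon> * e\<close>. Below, \<open>\<beta>\<close> is chosen to make
        \<open>\<beta> + \<eta>\<close> equal to \<open>lam\<close>.\<close>
      then have "\<exists>lam \<Omega> \<omega> t. (\<forall>j\<in>{1..M}. \<Omega> j \<ge> 0 \<and>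
          (\<forall>\<xi>\<in>{a..b}. max 0 (s * \<xi> - lam) \<le> \<Omega> j * \<xi>\<^sup>2 + \<omega> j * \<xi> + t j)) \<and>
        (\<Sum>j=1..M. \<gamma> j * (t j + \<mu> j * \<omega> j + (\<sigma> j + (\<mu> j)\<^sup>2) * \<Omega> j)) \<le> \<epsilon> * \<kappa> - lam * \<epsilon> + \<epsilon> * e"
        using True \<open>0 < e\<close> \<epsilon> by (intro mixture_majorants[OF s finite_atLeastAtMost \<gamma> _ \<sigma>]) auto
      then obtain lam \<Omega> \<omega> t where maj: "\<forall>j\<in>{1..M}. \<Omega> j \<ge> 0 \<and>
          (\<forall>\<xi>\<in>{a..b}. max 0 (s * \<xi> - lam) \<le> \<Omega> j * \<xi>\<^sup>2 + \<omega> j * \<xi> + t j)"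
        and budget: "(\<Sum>j=1..M. \<gamma> j * (t j + \<mu> j * \<omega> j + (\<sigma> j + (\<mu> j)\<^sup>2) * \<Omega> j))
          \<le> \<epsilon> * \<kappa> - lam * \<epsilon> + \<epsilon> * e" by blast
      show ?thesis
      proof (rule value_le)
        show "\<epsilon> * (lam - (\<kappa> + e)) +
          (\<Sum>j=1..M. \<gamma> j * (t j + \<mu> j * \<omega> j + (\<sigma> j + (\<mu> j)\<^sup>2) * \<Omega> j)) \<le> 0"
          using budget by (simp add: algebra_simps)
        show "\<forall>j\<in>{1..M}. \<Omega> j \<ge> 0 \<and> (\<forall>\<xi>\<in>{a..b}.
          max 0 (s * \<xi> - (lam - (\<kappa> + e) + (\<kappa> + e))) \<le> \<Omega> j * \<xi>\<^sup>2 + \<omega> j * \<xi> + t j)"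
          using maj by simp
      qed
    qed
    then show "socp_value i \<epsilon> a b M \<gamma> \<mu> \<sigma> \<le> ereal \<kappa> + ereal e" by simp
  qed
qed

section \<open>From the scalar equivalence to the constraints on the state vector\<close>

theorem theorem1:
  fixes A :: "real^'n^'n" and B :: "real^'m^'n" and K :: "real^'n^'m"
    and N :: "'o measure" and w :: "real^'n \<Rightarrow> 'o \<Rightarrow> real^'n"
    and w1 w2 :: "real^'n"
    and xc :: "nat \<Rightarrow> real^'n"
    and \<epsilon> :: real
    and M :: "'n \<Rightarrow> real^'n \<Rightarrow> nat"
    and \<mu> \<sigma> :: "'n \<Rightarrow> real^'n \<Rightarrow> nat \<Rightarrow> real"
    and \<gamma> :: "'n \<Rightarrow> nat \<Rightarrow> real"
    and x s0 s1 z :: "real^'n" and v0 :: "real^'m"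
    and x1 :: "'o \<Rightarrow> real^'n"
    and W Q :: "'n \<Rightarrow> real measure set"
    and dr_constraint :: "nat \<Rightarrow> 'n \<Rightarrow> bool"
    and \<eta> :: "nat \<Rightarrow> ereal^'n"
  assumes "stabilizable A B"
    and "schur_stable (A + B ** K)"
    and "prob_space N"
    and "\<And>y. w y \<in> borel_measurable N"
    and "\<And>y h. h \<in> space N \<Longrightarrow> w y h \<in> {w1..w2}"
    and "0 < \<epsilon>" and "\<epsilon> < 1"
    and "\<And>\<tau> j. j \<in> {1..M \<tau> x} \<Longrightarrow> \<sigma> \<tau> x j \<ge> 0"
    and "\<And>\<tau> j. j \<in> {1..M \<tau> x} \<Longrightarrow> \<gamma> \<tau> j > 0"
    and "\<And>\<tau>. (\<Sum>j=1..M \<tau> x. \<gamma> \<tau> j) = 1"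
    and "s1 = A *v s0 + B *v v0"
    and "x1 = (\<lambda>h. (A + B ** K) *v x - (B ** K) *v s0 + B *v v0 + w x h)"
    and "z = s1 + (A + B ** K) *v (x - s0)"
    and "W = (\<lambda>\<tau>. disturbance_ambiguity (w1 $ \<tau>) (w2 $ \<tau>) (M \<tau> x) (\<gamma> \<tau>) (\<mu> \<tau> x) (\<sigma> \<tau> x))"
    and "Q = (\<lambda>\<tau>. shifted_ambiguity (z $ \<tau>) (W \<tau>))"
    and "dr_constraint =
      (\<lambda>i \<tau>. (SUP q \<in> Q \<tau>. cvar \<epsilon> q (\<lambda>y. (-1)^i * (y - xc i $ \<tau>))) \<le> 0)"
    and "\<eta> = (\<lambda>i. \<chi> \<tau>. socp_value i \<epsilon> (w1 $ \<tau>) (w2 $ \<tau>) (M \<tau> x) (\<gamma> \<tau>) (\<mu> \<tau> x) (\<sigma> \<tau> x))"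
  shows "(\<forall>h \<in> space N. x1 h = z + w x h) \<and>
    (\<forall>\<tau>. \<forall>i\<in>{1,2}.
      dr_constraint i \<tau> \<longleftrightarrow>
        ereal ((-1)^i * (s1 $ \<tau> + ((A + B ** K) *v (x - s0)) $ \<tau>))
          \<le> ereal ((-1)^i * xc i $ \<tau>) - \<eta> i $ \<tau>) \<and>
    ((\<forall>i\<in>{1,2}. \<forall>\<tau>. dr_constraint i \<tau>) \<longleftrightarrow>
      ereal_vec (s1 + (A + B ** K) *v (x - s0))
        \<in> {ereal_vec (xc 1) + \<eta> 1 .. ereal_vec (xc 2) - \<eta> 2})"
proof -
  \<comment> \<open>A probability space has an outcome, and the disturbance there lies in the box;
    so every side of the box is a nonempty interval.\<close>
  have "\<exists>h. h \<in> space N"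
    using prob_space.not_empty[OF \<open>prob_space N\<close>] by blast
  then have box: "w1 $ \<tau> \<le> w2 $ \<tau>" for \<tau>
    using assms(5)[of _ x] by (auto simp: less_eq_vec_def intro: order_trans)
  have dynamics: "\<forall>h\<in>space N. x1 h = z + w x h"
    unfolding assms(11-13)
    by (simp add: matrix_vector_mult_diff_distrib matrix_vector_mult_add_rdistrib)
  have tightened: "dr_constraint i \<tau> \<longleftrightarrow> \<eta> i $ \<tau> \<le> ereal ((-1)^i * (xc i $ \<tau> - z $ \<tau>))" for i \<tau>
    unfolding assms(14-17) vec_lambda_beta
    using assms(6-10) box by (intro dr_cvar_iff_socp_value) auto
  have z: "s1 $ \<tau> + ((A + B ** K) *v (x - s0)) $ \<tau> = z $ \<tau>" for \<tau>
    by (simp add: assms(13))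
  have constraint: "dr_constraint i \<tau> \<longleftrightarrow>
      ereal ((-1)^i * z $ \<tau>) \<le> ereal ((-1)^i * xc i $ \<tau>) - \<eta> i $ \<tau>" for i \<tau>
    unfolding tightened by (cases "\<eta> i $ \<tau>") (auto simp: algebra_simps)
  have lower: "dr_constraint 1 \<tau> \<longleftrightarrow> ereal_vec (xc 1) $ \<tau> + \<eta> 1 $ \<tau> \<le> ereal_vec z $ \<tau>" for \<tau>
    unfolding tightened by (cases "\<eta> 1 $ \<tau>") (auto simp: ereal_vec_def)
  have upper: "dr_constraint 2 \<tau> \<longleftrightarrow> ereal_vec z $ \<tau> \<le> ereal_vec (xc 2) $ \<tau> - \<eta> 2 $ \<tau>" for \<tau>
    unfolding constraint by (simp add: ereal_vec_def)
  have "(\<forall>i\<in>{1,2}. \<forall>\<tau>. dr_constraint i \<tau>) \<longleftrightarrow>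
      (\<forall>\<tau>. dr_constraint 1 \<tau>) \<and> (\<forall>\<tau>. dr_constraint 2 \<tau>)" by simp
  also have "\<dots> \<longleftrightarrow> ereal_vec z \<in> {ereal_vec (xc 1) + \<eta> 1 .. ereal_vec (xc 2) - \<eta> 2}"
    unfolding lower upper
    by (simp only: atLeastAtMost_iff less_eq_vec_def vector_add_component vector_minus_component)
  finally have joint: "(\<forall>i\<in>{1,2}. \<forall>\<tau>. dr_constraint i \<tau>) \<longleftrightarrow>
      ereal_vec z \<in> {ereal_vec (xc 1) + \<eta> 1 .. ereal_vec (xc 2) - \<eta> 2}" .
  show ?thesis
    unfolding z assms(13)[symmetric] using dynamics constraint joint by simp
qed

end
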